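(* Let $\lambda\in(0,1)$. There exist positive constants $C_1',C_2'$ such that for every $k\in\mathbb N$, $k\ge1$, $$C_1'k\le\gamma^\lambda(\lambda,k)\le C_2'k,$$ where $\gamma^\lambda(\lambda,k)$ is the quantity $\gamma^\lambda(\rho,k)$ for the choice $\rho=\lambda$.
   Context: Vectors and lattice. Let $\mathrm w_1=(1,0)$, $\mathrm w_2=(\frac12,\frac{\sqrt3}2)$. For $\rho\in(0,1]$ put $\mathcal L_1^-=\{\xi_1\mathrm w_1+\xi_2\mathrm w_2\colon\xi_1,\xi_2\in\mathbb Z,\ \xi_1<0\}$, $\mathcal L_\rho^+=\{\xi_1\mathrm w_1+\xi_2\mathrm w_2\colon\xi_1,\xi_2\in\rho\mathbb Z,\ \xi_1\ge0\}$, $\mathcal L_\rho=\mathcal L_1^-\cup\mathcal L_\rho^+$. Triangulation $\mathcal T_\rho$ and nearest neighbours. A triangulation of $\mathcal L_\rho$ (partition of $\mathbb R^2$, up to boundaries, into open nonempty triangles with vertices in $\mathcal L_\rho$) has the Delaunay property if the circumcircle of each triangle contains no points of $\mathcal L_\rho$ in its interior. Put $P_i=-\mathrm w_1+i\mathrm w_2$, $Q_j=j\rho\mathrm w_2$ ($i,j\in\mathbb Z$). The triangulation with the Delaunay property is unique unless for some $i,j$ the points $P_i,P_{i+1},Q_j,Q_{j+1}$ lie on a common circle. $\mathcal T_\rho$ denotes the triangulation of $\mathcal L_\rho$ with the Delaunay property in which, by convention, every such concyclic 4-tuple is triangulated by $P_iQ_jQ_{j+1}$ and $P_iP_{i+1}Q_{j+1}$.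 Two distinct points of $\mathcal L_\rho$ are nearest neighbours (NN) if they are vertices of one and the same triangle of $\mathcal T_\rho$. Transition cost. Let $\Omega_{k,\infty}=\mathbb R\times(0,\frac{\sqrt3}2k)$, $\mathcal L_{\rho,\infty}(k)=\mathcal L_\rho\cap\overline\Omega_{k,\infty}$, and let $\mathcal L^-_{1,\infty}(k)$, $\mathcal L^+_{\rho,\infty}(k)$ be its subsets of points $\xi_1\mathrm w_1+\xi_2\mathrm w_2$ with $\xi_1<0$, respectively $\xi_1\ge0$. $\mathcal A_{\rho,\infty}(\Omega_{k,\infty})$ is the set of $u\in C^0(\overline\Omega_{k,\infty};\mathbb R^2)$ piecewise affine with $\nabla u$ constant on $\Omega_{k,\infty}\cap T$ for all $T\in\mathcal T_\rho$ and $\det\nabla u>0$ a.e. For such $u$, $$\mathcal E_\infty^\lambda(u,\rho,k)=\tfrac12\sum_{\substack{x,y\ \mathrm{NN}\\ x\in\mathcal L^-_{1,\infty}(k),\,y\in\mathcal L_{\rho,\infty}(k)}}(|u(x)-u(y)|-1)^2+\tfrac12\sum_{\substack{x,y\ \mathrm{NN}\\ x\in\mathcal L^+_{\rho,\infty}(k),\,y\in\mathcal L_{\rho,\infty}(k)}}(|u(x)-u(y)|-\lambda)^2,$$ the sums being over ordered pairs $(x,y)$. Then $\gamma^\lambda(\rho,k)$ is the infimum of $\mathcal E^\lambda_\infty(v,\rho,k)$ over all $M>0$ and $v\in\mathcal A_{\rho,\infty}(\Omega_{k,\infty})$ with $\nabla v=I$ for $x_1\in(-\infty,-M)$ and $\nabla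 v=\frac\lambda\rho I$ for $x_1\in(M,+\infty)$. *)

theory Defs
  imports "HOL-Analysis.Analysis"
begin

definition w1 :: "real ^ 2" where "w1 = vector [1, 0]"

definition w2 :: "real ^ 2" where "w2 = vector [1 / 2, sqrt 3 / 2]"

definition lattice_minus :: "(real ^ 2) set" where
  "lattice_minus = {of_int a *\<^sub>R w1 + of_int b *\<^sub>R w2 | a b :: int. a < 0}"

definition lattice_plus :: "real \<Rightarrow> (real ^ 2) set" where
  "lattice_plus \<rho> =
     {(\<rho> * of_int a) *\<^sub>R w1 + (\<rho> * of_int b) *\<^sub>R w2 | a b :: int. 0 \<le> \<rho> * of_int a}"

definition bilattice :: "real \<Rightarrow> (real ^ 2) set" where
  "bilattice \<rho> = lattice_minus \<union> lattice_plus \<rho>"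

definition Ppt :: "int \<Rightarrow> real ^ 2" where
  "Ppt i = - w1 + of_int i *\<^sub>R w2"

definition Qpt :: "real \<Rightarrow> int \<Rightarrow> real ^ 2" where
  "Qpt \<rho> j = (of_int j * \<rho>) *\<^sub>R w2"

text \<open>
  A triangle is represented by the set \<open>V\<close> of its three vertices; the open triangle is then
  \<open>interior (convex hull V)\<close>, which is nonempty because \<open>V\<close> is not collinear.
\<close>

definition open_triangle :: "(real ^ 2) set \<Rightarrow> (real ^ 2) set" where
  "open_triangle V = interior (convex hull V)"

definition triangulation_of :: "(real ^ 2) set \<Rightarrow> (real ^ 2) set set \<Rightarrow> bool" where
  "triangulation_of L \<T> \<longleftrightarrow>
     (\<forall>V\<in>\<T>. V \<subseteq> L \<and> card V = 3 \<and> \<not> collinear V) \<and>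
     (\<forall>V\<in>\<T>. \<forall>W\<in>\<T>. V \<noteq> W \<longrightarrow> open_triangle V \<inter> open_triangle W = {}) \<and>
     (\<Union>V\<in>\<T>. convex hull V) = UNIV"

text \<open>The circle through three non-collinear points exists and is unique.\<close>

definition delaunay :: "(real ^ 2) set \<Rightarrow> (real ^ 2) set set \<Rightarrow> bool" where
  "delaunay L \<T> \<longleftrightarrow> (\<forall>V\<in>\<T>. \<exists>c r. V \<subseteq> sphere c r \<and> ball c r \<inter> L = {})"

definition concyclic :: "(real ^ 2) set \<Rightarrow> bool" where
  "concyclic S \<longleftrightarrow> (\<exists>c r. S \<subseteq> sphere c r)"

definition tri_convention :: "real \<Rightarrow> (real ^ 2) set set \<Rightarrow> bool" where
  "tri_convention \<rho> \<T> \<longleftrightarrow>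
     (\<forall>i j. concyclic {Ppt i, Ppt (i + 1), Qpt \<rho> j, Qpt \<rho> (j + 1)} \<longrightarrow>
        {Ppt i, Qpt \<rho> j, Qpt \<rho> (j + 1)} \<in> \<T> \<and> {Ppt i, Ppt (i + 1), Qpt \<rho> (j + 1)} \<in> \<T>)"

text \<open>
  For \<open>0 < \<rho> \<le> 1\<close> exactly one triangulation has the three properties: by the Delaunay property the
  only freedom is the diagonal of each concyclic quadrilateral, which the convention fixes.
\<close>

definition tri :: "real \<Rightarrow> (real ^ 2) set set" where
  "tri \<rho> = (THE \<T>. triangulation_of (bilattice \<rho>) \<T> \<and> delaunay (bilattice \<rho>) \<T> \<and> tri_convention \<rho> \<T>)"

definition NN :: "real \<Rightarrow> real ^ 2 \<Rightarrow> real ^ 2 \<Rightarrow> bool" where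
  "NN \<rho> x y \<longleftrightarrow> x \<noteq> y \<and> (\<exists>V\<in>tri \<rho>. x \<in> V \<and> y \<in> V)"

definition Omega :: "nat \<Rightarrow> (real ^ 2) set" where
  "Omega k = {x. 0 < x $ 2 \<and> x $ 2 < sqrt 3 / 2 * real k}"

definition strip_minus :: "nat \<Rightarrow> (real ^ 2) set" where
  "strip_minus k = lattice_minus \<inter> closure (Omega k)"

definition strip_plus :: "real \<Rightarrow> nat \<Rightarrow> (real ^ 2) set" where
  "strip_plus \<rho> k = lattice_plus \<rho> \<inter> closure (Omega k)"

definition strip :: "real \<Rightarrow> nat \<Rightarrow> (real ^ 2) set" where
  "strip \<rho> k = bilattice \<rho> \<inter> closure (Omega k)"

text \<open>
  Deformations are total functions; only their values on \<open>closure (Omega k)\<close> are ever used.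
\<close>

definition admissible :: "real \<Rightarrow> nat \<Rightarrow> (real ^ 2 \<Rightarrow> real ^ 2) set" where
  "admissible \<rho> k = {u.
     continuous_on (closure (Omega k)) u \<and>
     (\<forall>V\<in>tri \<rho>. \<exists>(A :: real ^ 2 ^ 2) b. \<forall>x\<in>Omega k \<inter> open_triangle V. u x = A *v x + b) \<and>
     (AE x in lebesgue. x \<in> Omega k \<longrightarrow>
        u differentiable (at x) \<and> 0 < det (jacobian u (at x)))}"

definition energy :: "real \<Rightarrow> real \<Rightarrow> nat \<Rightarrow> (real ^ 2 \<Rightarrow> real ^ 2) \<Rightarrow> ennreal" where
  "energy lam \<rho> k u =
     ennreal (1 / 2) * infsum (\<lambda>(x, y). ennreal ((norm (u x - u y) - 1)\<^sup>2))
       {(x, y). NN \<rho> x y \<and> x \<in> strip_minus k \<and> y \<in> strip \<rho> k} +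
     ennreal (1 / 2) * infsum (\<lambda>(x, y). ennreal ((norm (u x - u y) - lam)\<^sup>2))
       {(x, y). NN \<rho> x y \<and> x \<in> strip_plus \<rho> k \<and> y \<in> strip \<rho> k}"

text \<open>
  An admissible map is continuous and affine on triangles, so prescribing its gradient almost
  everywhere on a half-strip is the same as prescribing it at every point of the half-strip.
\<close>

definition competitors :: "real \<Rightarrow> real \<Rightarrow> nat \<Rightarrow> (real ^ 2 \<Rightarrow> real ^ 2) set" where
  "competitors lam \<rho> k = {v \<in> admissible \<rho> k. \<exists>M>0.
     (\<forall>x\<in>Omega k. x $ 1 < - M \<longrightarrow> (v has_derivative (\<lambda>h. h)) (at x)) \<and>
     (\<forall>x\<in>Omega k. x $ 1 > M \<longrightarrow> (v has_derivative (\<lambda>h. (lam / \<rho>) *\<^sub>R h)) (at x))}"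

definition transition_cost :: "real \<Rightarrow> real \<Rightarrow> nat \<Rightarrow> ennreal" where
  "transition_cost lam \<rho> k = (INF v\<in>competitors lam \<rho> k. energy lam \<rho> k v)"

end

theory Submission
  imports Defs
begin

text \<open>
  The bonds between a point \<open>P\<close> on the left of the interface and a point \<open>Q\<close> on its right decide
  both bounds. The sums run over ordered pairs, so such a bond of deformed length \<open>d\<close> is
  charged \<open>(d - 1)\<^sup>2 / 2\<close> as a pair \<open>(P, Q)\<close> and \<open>(d - lam)\<^sup>2 / 2\<close> as a pair \<open>(Q, P)\<close>. The total is at
  least \<open>(1 - lam)\<^sup>2 / 4\<close>, whatever the deformation is. For \<open>0 \<le> i < k\<close> the segment from \<open>Ppt i\<close> to
  \<open>Ppt (i + 1)\<close> is a side of a triangle with third vertex \<open>Qpt lam j\<close> in the strip; these \<open>k\<close> bonds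
  give the lower bound (\<open>energy_ge\<close>). Conversely, for \<open>\<rho> = lam\<close> the two prescribed gradients
  coincide, so the identity is a competitor. All its bonds within one sublattice have their rest
  length, a bond across the interface costs at most a constant, and the strip contains \<open>O(k)\<close> of them
  (\<open>crossing_card\<close>, \<open>energy_identity_le\<close>).

  The substance of the proof is the description of the nearest neighbours, that is, the existence and
  uniqueness of the triangulation \<open>tri \<rho>\<close>. The lattice consists of parallel rows of equally spaced
  points, and the square of half the spacing of a row is smaller than the product of the distances to
  the two adjacent rows. Under this hypothesis (locale \<open>layered\<close>) a circle that meets two rows which
  are not adjacent encloses a lattice point, so that Delaunay triangles join two adjacent rows
  (\<open>delaunay_triangle_cases\<close>). Between adjacent rows, two points are joined when the Voronoi
  intervals of their coordinates along the rows overlap (\<open>edge\<close>). These edges form a chain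
  for the componentwise order of the indices, and two consecutive edges are sides of one triangle. The triangles obtained in this way have disjoint interiors because the edges separate them
  (\<open>tris_disjoint\<close>), cover the plane (\<open>tris_cover\<close>), and are Delaunay (\<open>tris_delaunay\<close>). Any other
  Delaunay triangle comes from a concyclic quadruple and overlaps a triangle prescribed by the
  convention (\<open>delaunay_triangulation_unique\<close>).
\<close>

section \<open>Coordinates adapted to the interface\<close>

text \<open>
  The coordinates of a point in the orthonormal basis consisting of \<open>w2\<close>, which is tangential to the
  interface, and of the unit normal pointing to the right.
\<close>

definition tco :: "real ^ 2 \<Rightarrow> real" where
  "tco x = x $ 1 / 2 + sqrt 3 / 2 * x $ 2"

definition hco :: "real ^ 2 \<Rightarrow> real" where
  "hco x = sqrt 3 / 2 * x $ 1 - x $ 2 / 2"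

text \<open>The point with given tangential and normal coordinates.\<close>

definition pt :: "real \<Rightarrow> real \<Rightarrow> real ^ 2" where
  "pt t h = vector [t / 2 + sqrt 3 / 2 * h, sqrt 3 / 2 * t - h / 2]"

lemma sqrt3: "sqrt 3 * sqrt 3 = (3::real)" "sqrt 3 * (sqrt 3 * x) = 3 * (x::real)"
  by (simp_all flip: mult.assoc)

lemma tco_pt [simp]: "tco (pt t h) = t" and hco_pt [simp]: "hco (pt t h) = h"
  by (simp_all add: tco_def hco_def pt_def field_simps sqrt3)

lemma tco_linear [simp]:
  "tco (x + y) = tco x + tco y" "tco (x - y) = tco x - tco y" "tco (c *\<^sub>R x) = c * tco x" "tco 0 = 0"
  by (simp_all add: tco_def field_simps)

lemma hco_linear [simp]:
  "hco (x + y) = hco x + hco y" "hco (x - y) = hco x - hco y" "hco (c *\<^sub>R x) = c * hco x" "hco 0 = 0"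
  by (simp_all add: hco_def field_simps)

lemma pt_tco_hco [simp]: "pt (tco x) (hco x) = x"
proof -
  have "x $ 1 = tco x / 2 + sqrt 3 / 2 * hco x" "x $ 2 = sqrt 3 / 2 * tco x - hco x / 2"
    by (simp_all add: tco_def hco_def field_simps sqrt3)
  then show ?thesis by (simp add: pt_def vec_eq_iff forall_2)
qed

lemma coords_eqI: "tco x = tco y \<Longrightarrow> hco x = hco y \<Longrightarrow> x = y"
  by (metis pt_tco_hco)

lemma pt_eq_iff [simp]: "pt t h = pt t' h' \<longleftrightarrow> t = t' \<and> h = h'"
  by (metis tco_pt hco_pt)

lemma inner_pt: "pt a b \<bullet> x = a * tco x + b * hco x"
  by (simp add: inner_vec_def sum_2 pt_def tco_def hco_def field_simps)

lemma norm_sq_coords: "(norm x)\<^sup>2 = (tco x)\<^sup>2 + (hco x)\<^sup>2"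
  unfolding power2_norm_eq_inner using inner_pt[of "tco x" "hco x" x] by (simp add: power2_eq_square)

lemma dist_sq_coords: "(dist x y)\<^sup>2 = (tco x - tco y)\<^sup>2 + (hco x - hco y)\<^sup>2"
  by (simp add: dist_norm norm_sq_coords)

section \<open>Open triangles and triangulations\<close>

text \<open>Vertex sets separated by a line span triangles with disjoint interiors.\<close>

lemma open_triangle_disjoint:
  assumes nz: "a \<noteq> 0 \<or> b \<noteq> 0"
    and V: "\<And>x. x \<in> V \<Longrightarrow> a * tco x + b * hco x \<le> c"
    and W: "\<And>x. x \<in> W \<Longrightarrow> c \<le> a * tco x + b * hco x"
  shows "open_triangle V \<inter> open_triangle W = {}"
proof -
  have u: "pt a b \<noteq> 0" using nz by (metis pt_tco_hco tco_pt hco_pt tco_linear(4) hco_linear(4))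
  have "convex hull V \<subseteq> {x. pt a b \<bullet> x \<le> c}"
    by (intro hull_minimal convex_halfspace_le subsetI) (simp add: inner_pt V)
  then have 1: "open_triangle V \<subseteq> {x. pt a b \<bullet> x < c}"
    unfolding open_triangle_def using interior_mono u by (metis interior_halfspace_le)
  have "convex hull W \<subseteq> {x. pt a b \<bullet> x \<ge> c}"
    by (intro hull_minimal convex_halfspace_ge subsetI) (simp add: inner_pt W)
  then have "open_triangle W \<subseteq> {x. pt a b \<bullet> x > c}"
    unfolding open_triangle_def using interior_mono u by (metis interior_halfspace_ge)
  with 1 show ?thesis by force
qed

lemma open_triangle_eq:
  fixes a b c :: "real ^ 2"
  assumes "\<not> collinear {a, b, c}"
  shows "open_triangle {a, b, c} =
    {x *\<^sub>R a + y *\<^sub>R b + z *\<^sub>R c | x y z. 0 < x \<and> 0 < y \<and> 0 < z \<and> x + y + z = 1}"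
  unfolding open_triangle_def by (subst interior_convex_hull_3_minimal) (use assms in auto)

lemma open_triangle_nonempty:
  assumes "card V = 3" "\<not> collinear V"
  shows "open_triangle V \<noteq> {}"
proof -
  obtain a b c where V: "V = {a, b, c}" using assms(1) by (auto simp: card_3_iff)
  have "(1/3) *\<^sub>R a + (1/3) *\<^sub>R b + (1/3) *\<^sub>R c \<in> open_triangle {a, b, c}"
    using assms(2) unfolding V
    by (subst open_triangle_eq)
      (auto intro!: exI[of _ "1/3 :: real"])
  then show ?thesis unfolding V by blast
qed

text \<open>Two triangles on the same side of a common side overlap.\<close>

lemma open_triangle_overlap:
  fixes a b v :: "real ^ 2"
  assumes "0 < d" "0 < d'"
    and nc: "\<not> collinear {a, a + d *\<^sub>R v, b}" "\<not> collinear {a, b, b + d' *\<^sub>R v}"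
  shows "open_triangle {a, a + d *\<^sub>R v, b} \<inter> open_triangle {a, b, b + d' *\<^sub>R v} \<noteq> {}"
proof -
  \<comment> \<open>A small shift in direction \<open>v\<close> of the midpoint of the common side stays inside both triangles.\<close>
  define e where "e = min d d' / 4"
  define x where "x = (1/2) *\<^sub>R a + (1/2) *\<^sub>R b + e *\<^sub>R v"
  have e: "0 < e" "e / d < 1/2" "e / d' < 1/2"
    using assms(1,2) by (auto simp: e_def field_simps)
  have "x = (1/2 - e/d) *\<^sub>R a + (e/d) *\<^sub>R (a + d *\<^sub>R v) + (1/2) *\<^sub>R b"
    using assms(1) by (simp add: x_def algebra_simps)
  then have 1: "x \<in> open_triangle {a, a + d *\<^sub>R v, b}"
    unfolding open_triangle_eq[OF nc(1)] using e assms(1)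
    by (intro CollectI exI[of _ "1/2 - e/d"] exI[of _ "e/d"] exI[of _ "1/2"]) auto
  have "x = (1/2) *\<^sub>R a + (1/2 - e/d') *\<^sub>R b + (e/d') *\<^sub>R (b + d' *\<^sub>R v)"
    using assms(2) by (simp add: x_def algebra_simps)
  then have "x \<in> open_triangle {a, b, b + d' *\<^sub>R v}"
    unfolding open_triangle_eq[OF nc(2)] using e assms(2)
    by (intro CollectI exI[of _ "1/2 - e/d'"] exI[of _ "e/d'"] exI[of _ "1/2"]) auto
  with 1 show ?thesis by blast
qed

lemma triangulation_subset_eq:
  assumes T: "triangulation_of L T" and T': "triangulation_of L T'" and sub: "T \<subseteq> T'"
  shows "T = T'"
proof (rule ccontr)
  assume "T \<noteq> T'"
  then obtain V where V: "V \<in> T'" "V \<notin> T" using sub by blast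
  have "open_triangle V \<noteq> {}"
    using T' V(1) open_triangle_nonempty by (auto simp: triangulation_of_def)
  then obtain x where x: "x \<in> open_triangle V" by blast
  have "x \<in> (\<Union>W\<in>T. convex hull W)" using T by (auto simp: triangulation_of_def)
  then obtain W where W: "W \<in> T" "x \<in> convex hull W" by blast
  have ne: "interior (convex hull W) \<noteq> {}"
    using T W(1) open_triangle_nonempty by (auto simp: triangulation_of_def open_triangle_def)
  have "convex hull W \<subseteq> closure (open_triangle W)"
    unfolding open_triangle_def
    using convex_closure_interior[OF convex_convex_hull ne] closure_subset by auto
  moreover have "open_triangle V \<inter> open_triangle W = {}"
    using T' V W(1) sub unfolding triangulation_of_def by (metis subsetD)
  then have "open_triangle V \<inter> closure (open_triangle W) = {}"
    by (simp add: open_Int_closure_eq_empty open_triangle_def)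
  ultimately show False using x W(2) by blast
qed

section \<open>Layered point sets and their triangulation\<close>

text \<open>
  Rows of equally spaced points: row \<open>m\<close> lies at height (normal coordinate) \<open>H m\<close> and consists of the
  points with tangential coordinates \<open>off m + i * D m\<close>. The assumption \<open>gap\<close> forces a circle that meets
  the rows \<open>m - 1\<close> and \<open>m + 1\<close> to cut row \<open>m\<close> in a chord longer than the spacing \<open>D m\<close>.
\<close>

locale layered =
  fixes H D off :: "int \<Rightarrow> real"
  assumes D_pos: "0 < D m"
    and H_less_Suc: "H m < H (m + 1)"
    and gap: "(D m)\<^sup>2 / 4 < (H m - H (m - 1)) * (H (m + 1) - H m)"
    and H_lower: "\<exists>m. H m \<le> h"
    and H_upper: "\<exists>m. h < H m"
begin

text \<open>Tangential coordinate of the point \<open>i\<close> of row \<open>m\<close>.\<close>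

definition pos :: "int \<Rightarrow> int \<Rightarrow> real" where
  "pos m i = off m + of_int i * D m"

text \<open>Tangential coordinate of the midpoint of the points \<open>i\<close> and \<open>i + 1\<close> of row \<open>m\<close>.\<close>

definition mid :: "int \<Rightarrow> int \<Rightarrow> real" where
  "mid m i = off m + (of_int i + 1 / 2) * D m"

text \<open>The point \<open>i\<close> of row \<open>m\<close>, and the whole point set.\<close>

definition X :: "int \<Rightarrow> int \<Rightarrow> real ^ 2" where
  "X m i = pt (pos m i) (H m)"

definition points :: "(real ^ 2) set" where
  "points = {X m i | m i. True}"

text \<open>
  Point \<open>p\<close> of row \<open>m\<close> and point \<open>q\<close> of row \<open>m + 1\<close> are joined when the sets of tangential coordinates
  to which they are nearest in their rows, the intervals \<open>[mid m (p - 1), mid m p]\<close> and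
  \<open>[mid (m + 1) (q - 1), mid (m + 1) q]\<close>, overlap. If they have only an endpoint in common, two
  diagonals compete, and the asymmetry between \<open>\<le>\<close> and \<open><\<close> selects one of them.
\<close>

definition edge :: "int \<Rightarrow> int \<Rightarrow> int \<Rightarrow> bool" where
  "edge m p q \<longleftrightarrow> mid (m + 1) (q - 1) \<le> mid m p \<and> mid m (p - 1) < mid (m + 1) q"

text \<open>The triangles with two vertices in the lower row and in the upper row, respectively.\<close>

definition lower_tri :: "int \<Rightarrow> int \<Rightarrow> int \<Rightarrow> (real ^ 2) set" where
  "lower_tri m i j = {X m i, X m (i + 1), X (m + 1) j}"

definition upper_tri :: "int \<Rightarrow> int \<Rightarrow> int \<Rightarrow> (real ^ 2) set" where
  "upper_tri m i j = {X m i, X (m + 1) j, X (m + 1) (j + 1)}"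

text \<open>A triangle belongs to the triangulation when its two sides between the rows are edges.\<close>

definition tris :: "(real ^ 2) set set" where
  "tris = {lower_tri m i j | m i j. edge m i j \<and> edge m (i + 1) j} \<union>
          {upper_tri m i j | m i j. edge m i j \<and> edge m i (j + 1)}"

text \<open>
  Two segments between consecutive points of adjacent rows are chords of a common circle if and only
  if their midpoints have the same tangential coordinate. In each such quadrilateral the convention
  prescribes the diagonal from the point \<open>i\<close> of the lower row to the point \<open>j + 1\<close> of the upper row.
\<close>

definition ties_in :: "(real ^ 2) set set \<Rightarrow> bool" where
  "ties_in T \<longleftrightarrow> (\<forall>m i j. mid m i = mid (m + 1) j \<longrightarrow>
     upper_tri m i j \<in> T \<and> lower_tri m i (j + 1) \<in> T)"

lemma H_strict_mono: "m < n \<Longrightarrow> H m < H n"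
proof (induction n rule: int_gr_induct)
  case base then show ?case using H_less_Suc by blast
next
  case (step i) then show ?case using H_less_Suc[of i] by linarith
qed

lemma H_less_iff [simp]: "H m < H n \<longleftrightarrow> m < n"
  by (metis H_strict_mono linorder_neqE less_asym less_irrefl)

lemma H_le_iff [simp]: "H m \<le> H n \<longleftrightarrow> m \<le> n"
  by (simp flip: not_less)

lemma H_eq_iff [simp]: "H m = H n \<longleftrightarrow> m = n"
  by (simp add: order_eq_iff)

lemma pos_less_iff [simp]: "pos m i < pos m j \<longleftrightarrow> i < j"
  using D_pos[of m] by (simp add: pos_def)

lemma pos_le_iff [simp]: "pos m i \<le> pos m j \<longleftrightarrow> i \<le> j"
  using D_pos[of m] by (simp add: pos_def)

lemma pos_eq_iff [simp]: "pos m i = pos m j \<longleftrightarrow> i = j"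
  by (simp add: order_eq_iff)

lemma mid_less_iff [simp]: "mid m i < mid m j \<longleftrightarrow> i < j"
  using D_pos[of m] by (simp add: mid_def)

lemma mid_le_iff [simp]: "mid m i \<le> mid m j \<longleftrightarrow> i \<le> j"
  using D_pos[of m] by (simp add: mid_def)

lemma pos_plus_1: "pos m (i + 1) = pos m i + D m"
  by (simp add: pos_def algebra_simps)

lemma pos_1_plus: "pos m (1 + i) = pos m i + D m"
  by (simp add: pos_def algebra_simps)

lemma mid_eq_pos: "mid m i = pos m i + D m / 2" and mid_pred_eq_pos: "mid m (i - 1) = pos m i - D m / 2"
  by (simp_all add: mid_def pos_def algebra_simps)

lemma tco_X [simp]: "tco (X m i) = pos m i" and hco_X [simp]: "hco (X m i) = H m"
  by (simp_all add: X_def)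

lemma X_eq_iff [simp]: "X m i = X n j \<longleftrightarrow> m = n \<and> i = j"
  by (auto simp: X_def)

text \<open>
  The third vertex of a triangle is the point of its row nearest to the midpoint of the opposite
  side, with ties resolved by the convention.
\<close>

lemma edge_lower_iff:
  "edge m i j \<and> edge m (i + 1) j \<longleftrightarrow> mid (m + 1) (j - 1) \<le> mid m i \<and> mid m i < mid (m + 1) j"
proof -
  have "mid m (i - 1) < mid m i" "mid m i < mid m (i + 1)" by simp_all
  then show ?thesis unfolding edge_def by (smt (verit) add_diff_cancel_right')
qed

lemma edge_upper_iff:
  "edge m i j \<and> edge m i (j + 1) \<longleftrightarrow> mid m (i - 1) < mid (m + 1) j \<and> mid (m + 1) j \<le> mid m i"
proof -
  have "mid (m + 1) (j - 1) < mid (m + 1) j" "mid (m + 1) j < mid (m + 1) (j + 1)" by simp_all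
  then show ?thesis unfolding edge_def by (smt (verit) add_diff_cancel_right')
qed

lemma edge_successor:
  assumes "edge m p q"
  shows "edge m (p + 1) q \<or> edge m p (q + 1)"
proof (cases "mid m p < mid (m + 1) q")
  case True
  then show ?thesis using assms edge_lower_iff[of m p q] unfolding edge_def by auto
next
  case False
  then show ?thesis using assms edge_upper_iff[of m p q] unfolding edge_def by auto
qed

text \<open>The edges between two adjacent rows do not cross.\<close>

lemma edge_chain:
  assumes "edge m p q" "edge m p' q'" "p < p'"
  shows "q \<le> q'"
proof (rule ccontr)
  assume "\<not> q \<le> q'"
  then have "mid (m + 1) q' \<le> mid (m + 1) (q - 1)" by simp
  moreover have "mid m p \<le> mid m (p' - 1)" using assms(3) by simp
  ultimately show False using assms(1,2) unfolding edge_def by linarith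
qed

lemma edge_eqI:
  assumes "edge m p q" "edge m p' q'" "p + q = p' + q'"
  shows "p = p' \<and> q = q'"
  using edge_chain[OF assms(1,2)] edge_chain[OF assms(2,1)] assms(3) by linarith

lemma edge_pos_diff:
  assumes "edge m p q"
  shows "\<bar>pos m p - pos (m + 1) q\<bar> \<le> (D m + D (m + 1)) / 2"
  using assms unfolding edge_def mid_pred_eq_pos unfolding mid_eq_pos abs_le_iff by (simp add: field_simps)

lemma ex_edge_lower: "\<exists>q. edge m p q \<and> edge m (p + 1) q"
proof -
  let ?q = "\<lfloor>(mid m p - off (m + 1)) / D (m + 1) + 1 / 2\<rfloor>"
  have "of_int ?q \<le> (mid m p - off (m + 1)) / D (m + 1) + 1 / 2"
       "(mid m p - off (m + 1)) / D (m + 1) + 1 / 2 < of_int ?q + 1" by linarith+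
  then have "mid (m + 1) (?q - 1) \<le> mid m p" "mid m p < mid (m + 1) ?q"
    unfolding mid_def[of "m + 1"] using D_pos[of "m + 1"] by (simp_all add: field_simps)
  then show ?thesis using edge_lower_iff by blast
qed

lemma nearest_point: "\<exists>i. \<bar>pos m i - t\<bar> \<le> D m / 2"
proof -
  define y where "y = (t - off m) / D m"
  have t: "t = off m + y * D m" using D_pos[of m] by (simp add: y_def)
  define i where "i = round y"
  have "\<bar>of_int i - y\<bar> \<le> 1 / 2" unfolding i_def by (rule of_int_round_abs_le)
  then have "\<bar>of_int i - y\<bar> * D m \<le> 1 / 2 * D m"
    using D_pos[of m] by (intro mult_right_mono) auto
  moreover have "\<bar>pos m i - t\<bar> = \<bar>of_int i - y\<bar> * D m"
    using D_pos[of m] unfolding pos_def t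
    by (metis abs_mult abs_of_pos add_diff_cancel_left left_diff_distrib)
  ultimately show ?thesis by (auto intro!: exI[of _ i])
qed

lemma dist_X_sq: "(dist c (X m i))\<^sup>2 = (pos m i - tco c)\<^sup>2 + (H m - hco c)\<^sup>2"
  by (simp add: dist_sq_coords power2_commute)

lemma triangle_card:
  "card (lower_tri m i j) = 3" "card (upper_tri m i j) = 3"
  by (simp_all add: lower_tri_def upper_tri_def)

lemma not_collinear_rows:
  assumes "x \<in> V" "y \<in> V" "z \<in> V" "x \<noteq> y" "hco x = hco y" "hco z \<noteq> hco x"
  shows "\<not> collinear V"
proof
  assume "collinear V"
  then obtain u where u: "\<And>a b. a \<in> V \<Longrightarrow> b \<in> V \<Longrightarrow> \<exists>c. a - b = c *\<^sub>R u"
    unfolding collinear_def by blast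
  obtain c where c: "x - y = c *\<^sub>R u" using u assms by blast
  obtain d where d: "x - z = d *\<^sub>R u" using u assms by blast
  have "c \<noteq> 0" using c assms(4) by auto
  moreover have "c * hco u = 0" using arg_cong[OF c, of hco] assms(5) by simp
  ultimately have "hco u = 0" by simp
  then show False using arg_cong[OF d, of hco] assms(6) by simp
qed

lemma triangle_not_collinear:
  "\<not> collinear (lower_tri m i j)" "\<not> collinear (upper_tri m i j)"
proof -
  show "\<not> collinear (lower_tri m i j)"
    by (rule not_collinear_rows[where x = "X m i" and y = "X m (i + 1)" and z = "X (m + 1) j"])
      (simp_all add: lower_tri_def)
  show "\<not> collinear (upper_tri m i j)"
    by (rule not_collinear_rows[where x = "X (m + 1) j" and y = "X (m + 1) (j + 1)" and z = "X m i"])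
      (simp_all add: upper_tri_def)
qed

section \<open>Empty circles\<close>

text \<open>
  There is a circle cutting rows \<open>m\<close> and \<open>m + 1\<close> in chords with midpoints at tangential coordinate \<open>t\<close>
  and with half-lengths \<open>\<alpha>\<close> and \<open>\<beta>\<close>. When these are at most half the spacing of the rows, the assumption
  \<open>gap\<close> keeps all other rows outside the open disc.
\<close>

lemma empty_circle:
  assumes \<alpha>: "0 \<le> \<alpha>" "\<alpha> \<le> D m / 2" "\<And>i. \<alpha> \<le> \<bar>pos m i - t\<bar>"
    and \<beta>: "0 \<le> \<beta>" "\<beta> \<le> D (m + 1) / 2" "\<And>j. \<beta> \<le> \<bar>pos (m + 1) j - t\<bar>"
  obtains c r where "ball c r \<inter> points = {}"
    and "\<And>i. \<bar>pos m i - t\<bar> = \<alpha> \<Longrightarrow> X m i \<in> sphere c r"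
    and "\<And>j. \<bar>pos (m + 1) j - t\<bar> = \<beta> \<Longrightarrow> X (m + 1) j \<in> sphere c r"
proof -
  define a where "a = H m"
  define b where "b = H (m + 1)"
  have ab: "a < b" by (simp add: a_def b_def)
  define h where "h = (b\<^sup>2 - a\<^sup>2 + \<beta>\<^sup>2 - \<alpha>\<^sup>2) / (2 * (b - a))"
  define R where "R = (a - h)\<^sup>2 + \<alpha>\<^sup>2"
  have "2 * (b - a) * h = b\<^sup>2 - a\<^sup>2 + \<beta>\<^sup>2 - \<alpha>\<^sup>2"
    using ab by (simp add: h_def)
  then have R': "R = (b - h)\<^sup>2 + \<beta>\<^sup>2"
    by (simp add: R_def power2_eq_square algebra_simps)
  have R0: "0 \<le> R" by (simp add: R_def)
  define c where "c = pt t h"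
  have d: "(dist c (X n i))\<^sup>2 = (pos n i - t)\<^sup>2 + (H n - h)\<^sup>2" for n i
    by (simp add: dist_X_sq c_def)
  \<comment> \<open>Newton interpolation, at the heights \<open>a\<close> and \<open>b\<close>, of the monic quadratic \<open>(y - h)\<^sup>2 - R\<close>.\<close>
  have newton: "(b - a) * ((y - h)\<^sup>2 - R) = (y - b) * \<alpha>\<^sup>2 - (y - a) * \<beta>\<^sup>2 + (y - a) * (y - b) * (b - a)" for y
  proof -
    have "(b - a) * ((y - h)\<^sup>2 - R) = (y - a) * ((b - h)\<^sup>2 - R) - (y - b) * ((a - h)\<^sup>2 - R) + (y - a) * (y - b) * (b - a)"
      by (simp add: power2_eq_square algebra_simps)
    moreover have "(b - h)\<^sup>2 - R = - \<beta>\<^sup>2" "(a - h)\<^sup>2 - R = - \<alpha>\<^sup>2"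
      using R' by (simp_all add: R_def)
    ultimately show ?thesis by simp
  qed
  have out: "R \<le> (pos n i - t)\<^sup>2 + (H n - h)\<^sup>2" for n i
  proof -
    consider "n = m" | "n = m + 1" | "n < m" | "m + 1 < n" by linarith
    then show ?thesis
    proof cases
      case 1
      have "\<alpha>\<^sup>2 \<le> (pos m i - t)\<^sup>2" using \<alpha>(1) \<alpha>(3)[of i] by (simp add: abs_le_square_iff[symmetric])
      then show ?thesis unfolding 1 R_def a_def by simp
    next
      case 2
      have "\<beta>\<^sup>2 \<le> (pos (m + 1) i - t)\<^sup>2" using \<beta>(1) \<beta>(3)[of i] by (simp add: abs_le_square_iff[symmetric])
      then show ?thesis unfolding 2 R' b_def by simp
    next
      case 3
      then have y: "H n \<le> H (m - 1)" by simp
      have "H (m - 1) < a" by (simp add: a_def)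
      then have y': "H n < a" using y by linarith
      have "\<alpha>\<^sup>2 \<le> (D m)\<^sup>2 / 4" using power_mono[OF \<alpha>(2,1), of 2] by (simp add: power_divide)
      also have "\<dots> < (a - H (m - 1)) * (b - a)" using gap[of m] by (simp add: a_def b_def)
      also have "\<dots> \<le> (a - H n) * (b - a)" using y ab by (intro mult_right_mono) auto
      finally have "(b - H n) * \<alpha>\<^sup>2 \<le> (b - H n) * ((a - H n) * (b - a))"
        using y' ab by (intro mult_left_mono) auto
      moreover have "0 \<le> (a - H n) * \<beta>\<^sup>2" using y' by simp
      ultimately have "0 \<le> (b - a) * ((H n - h)\<^sup>2 - R)" unfolding newton
        by (simp add: algebra_simps)
      then have "R \<le> (H n - h)\<^sup>2" using ab by (simp add: zero_le_mult_iff)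
      then show ?thesis by (simp add: add_increasing)
    next
      case 4
      then have y: "H (m + 2) \<le> H n" by simp
      have "b < H (m + 2)" by (simp add: b_def)
      then have y': "b < H n" using y by linarith
      have "\<beta>\<^sup>2 \<le> (D (m + 1))\<^sup>2 / 4" using power_mono[OF \<beta>(2,1), of 2] by (simp add: power_divide)
      also have "\<dots> < (b - a) * (H (m + 2) - b)" using gap[of "m + 1"] by (simp add: a_def b_def add.commute)
      also have "\<dots> \<le> (b - a) * (H n - b)" using y ab by (intro mult_left_mono) auto
      finally have "(H n - a) * \<beta>\<^sup>2 \<le> (H n - a) * ((b - a) * (H n - b))"
        using y' ab by (intro mult_left_mono) auto
      moreover have "0 \<le> (H n - b) * \<alpha>\<^sup>2" using y' by simp
      ultimately have "0 \<le> (b - a) * ((H n - h)\<^sup>2 - R)" unfolding newton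
        by (simp add: algebra_simps)
      then have "R \<le> (H n - h)\<^sup>2" using ab by (simp add: zero_le_mult_iff)
      then show ?thesis by (simp add: add_increasing)
    qed
  qed
  show thesis
  proof
    have "sqrt R \<le> dist c (X n i)" for n i
      using out[where n = n and i = i] by (intro real_le_lsqrt) (simp_all add: d R0)
    then show "ball c (sqrt R) \<inter> points = {}" by (auto simp: points_def not_less[symmetric])
    show "X m i \<in> sphere c (sqrt R)" if "\<bar>pos m i - t\<bar> = \<alpha>" for i
    proof -
      have "(dist c (X m i))\<^sup>2 = R" unfolding d R_def a_def that[symmetric] by simp
      then show ?thesis by (metis mem_sphere real_sqrt_unique zero_le_dist)
    qed
    show "X (m + 1) j \<in> sphere c (sqrt R)" if "\<bar>pos (m + 1) j - t\<bar> = \<beta>" for j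
    proof -
      have "(dist c (X (m + 1) j))\<^sup>2 = R" unfolding d R' b_def that[symmetric] by simp
      then show ?thesis by (metis mem_sphere real_sqrt_unique zero_le_dist)
    qed
  qed
qed

lemma mid_nearest:
  assumes "mid m (i - 1) \<le> t" "t \<le> mid m i"
  shows "\<bar>pos m i - t\<bar> \<le> D m / 2" "\<bar>pos m i - t\<bar> \<le> \<bar>pos m k - t\<bar>"
proof -
  have t: "pos m i - D m / 2 \<le> t" "t \<le> pos m i + D m / 2" using assms unfolding mid_pred_eq_pos unfolding mid_eq_pos by simp_all
  then show "\<bar>pos m i - t\<bar> \<le> D m / 2" by linarith
  consider "k = i" | "i + 1 \<le> k" | "k + 1 \<le> i" by linarith
  then show "\<bar>pos m i - t\<bar> \<le> \<bar>pos m k - t\<bar>"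
  proof cases
    case 2
    then have "pos m i + D m \<le> pos m k" by (metis pos_le_iff pos_plus_1)
    then show ?thesis using t by linarith
  next
    case 3
    then have "pos m k + D m \<le> pos m i" by (metis pos_le_iff pos_plus_1)
    then show ?thesis using t by linarith
  qed simp
qed

lemma mid_ends:
  "\<bar>pos m i - mid m i\<bar> = D m / 2" "\<bar>pos m (i + 1) - mid m i\<bar> = D m / 2" "D m / 2 \<le> \<bar>pos m k - mid m i\<bar>"
proof -
  show 1: "\<bar>pos m i - mid m i\<bar> = D m / 2" and "\<bar>pos m (i + 1) - mid m i\<bar> = D m / 2"
    using D_pos[of m] by (simp_all add: mid_eq_pos pos_plus_1)
  show "D m / 2 \<le> \<bar>pos m k - mid m i\<bar>"
    using mid_nearest(2)[of m i "mid m i" k] 1 by simp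
qed

text \<open>In the case of a tie the circle also passes through the fourth point of the quadrilateral.\<close>

lemma lower_tri_circle:
  assumes "mid (m + 1) (j - 1) \<le> mid m i" "mid m i \<le> mid (m + 1) j"
  shows "\<exists>c r. lower_tri m i j \<subseteq> sphere c r \<and> ball c r \<inter> points = {} \<and>
    (mid m i = mid (m + 1) j \<longrightarrow> X (m + 1) (j + 1) \<in> sphere c r)"
proof -
  have D: "0 \<le> D m / 2" using D_pos[of m] by simp
  obtain c r where c: "ball c r \<inter> points = {}"
    "\<And>k. \<bar>pos m k - mid m i\<bar> = D m / 2 \<Longrightarrow> X m k \<in> sphere c r"
    "\<And>k. \<bar>pos (m + 1) k - mid m i\<bar> = \<bar>pos (m + 1) j - mid m i\<bar> \<Longrightarrow> X (m + 1) k \<in> sphere c r"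
    by (rule empty_circle[OF D order_refl mid_ends(3) abs_ge_zero mid_nearest[OF assms]]) (rule that; blast)
  have "X (m + 1) (j + 1) \<in> sphere c r" if "mid m i = mid (m + 1) j"
    using that mid_ends(1,2)[of "m + 1" j] by (intro c(3)) simp
  moreover have "lower_tri m i j \<subseteq> sphere c r"
    using c(2)[OF mid_ends(1)] c(2)[OF mid_ends(2)] c(3)[OF refl] by (simp add: lower_tri_def)
  ultimately show ?thesis using c(1) by blast
qed

lemma upper_tri_circle:
  assumes "mid m (i - 1) \<le> mid (m + 1) j" "mid (m + 1) j \<le> mid m i"
  shows "\<exists>c r. upper_tri m i j \<subseteq> sphere c r \<and> ball c r \<inter> points = {}"
proof -
  have D: "0 \<le> D (m + 1) / 2" using D_pos[of "m + 1"] by simp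
  obtain c r where c: "ball c r \<inter> points = {}"
    "\<And>k. \<bar>pos m k - mid (m + 1) j\<bar> = \<bar>pos m i - mid (m + 1) j\<bar> \<Longrightarrow> X m k \<in> sphere c r"
    "\<And>k. \<bar>pos (m + 1) k - mid (m + 1) j\<bar> = D (m + 1) / 2 \<Longrightarrow> X (m + 1) k \<in> sphere c r"
    by (rule empty_circle[OF abs_ge_zero mid_nearest[OF assms] D order_refl mid_ends(3)]) (rule that; blast)
  have "upper_tri m i j \<subseteq> sphere c r"
    using c(3)[OF mid_ends(1)] c(3)[OF mid_ends(2)] c(2)[OF refl] by (simp add: upper_tri_def)
  then show ?thesis using c(1) by blast
qed

lemma tris_delaunay: "delaunay points tris"
  unfolding delaunay_def
proof
  fix V assume "V \<in> tris"
  then consider m i j where "V = lower_tri m i j" "edge m i j \<and> edge m (i + 1) j"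
    | m i j where "V = upper_tri m i j" "edge m i j \<and> edge m i (j + 1)"
    unfolding tris_def by blast
  then show "\<exists>c r. V \<subseteq> sphere c r \<and> ball c r \<inter> points = {}"
  proof cases
    case (1 m i j)
    then show ?thesis unfolding edge_lower_iff using lower_tri_circle less_imp_le by metis
  next
    case (2 m i j)
    then show ?thesis unfolding edge_upper_iff using upper_tri_circle less_imp_le by metis
  qed
qed

section \<open>Disjointness and covering\<close>

text \<open>The line through the edge \<open>(p, q)\<close> separates the triangles before it from those after it.\<close>

lemma open_triangles_beside_edge:
  assumes V: "\<And>x. x \<in> V \<Longrightarrow> (\<exists>i\<le>p. x = X m i) \<or> (\<exists>j\<le>q. x = X (m + 1) j)"
    and W: "\<And>x. x \<in> W \<Longrightarrow> (\<exists>i\<ge>p. x = X m i) \<or> (\<exists>j\<ge>q. x = X (m + 1) j)"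
  shows "open_triangle V \<inter> open_triangle W = {}"
proof -
  define l where "l = (pos (m + 1) q - pos m p) / (H (m + 1) - H m)"
  have "H m < H (m + 1)" by simp
  then have l: "pos (m + 1) q - l * H (m + 1) = pos m p - l * H m"
    by (simp add: l_def field_simps)
  show ?thesis
  proof (rule open_triangle_disjoint[where a = 1 and b = "- l" and c = "pos m p - l * H m"])
    show "1 * tco x + (- l) * hco x \<le> pos m p - l * H m" if "x \<in> V" for x
      using V[OF that] l by auto (metis diff_right_mono pos_le_iff)
    show "pos m p - l * H m \<le> 1 * tco x + (- l) * hco x" if "x \<in> W" for x
      using W[OF that] l by auto (metis diff_right_mono pos_le_iff)
  qed simp
qed

lemma lower_lower_disjoint:
  assumes "edge m i j" "edge m i' j'" "i < i'"
  shows "open_triangle (lower_tri m i j) \<inter> open_triangle (lower_tri m i' j') = {}"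
  by (rule open_triangles_beside_edge[where p = "i + 1" and q = j and m = m])
    (use assms edge_chain[OF assms] in \<open>auto simp: lower_tri_def\<close>)

lemma upper_upper_disjoint:
  assumes "edge m i (j + 1)" "edge m i' j'" "i < i' \<or> i = i' \<and> j < j'"
  shows "open_triangle (upper_tri m i j) \<inter> open_triangle (upper_tri m i' j') = {}"
proof -
  have "i \<le> i'" "j + 1 \<le> j'" using assms edge_chain[OF assms(1,2)] by auto
  then show ?thesis
    by (intro open_triangles_beside_edge[where p = i and q = "j + 1" and m = m]) (auto simp: upper_tri_def)
qed

lemma lower_upper_disjoint:
  assumes "edge m i j" "edge m (i + 1) j" "edge m i' j'" "edge m i' (j' + 1)"
  shows "open_triangle (lower_tri m i j) \<inter> open_triangle (upper_tri m i' j') = {}"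
proof (cases "i < i'")
  case True
  then have "j \<le> j'" using edge_chain assms by blast
  then show ?thesis using True
    by (intro open_triangles_beside_edge[where p = "i + 1" and q = j and m = m])
      (auto simp: lower_tri_def upper_tri_def)
next
  case False
  then have "j' + 1 \<le> j" using edge_chain[OF assms(4,2)] by simp
  then have "open_triangle (upper_tri m i' j') \<inter> open_triangle (lower_tri m i j) = {}" using False
    by (intro open_triangles_beside_edge[where p = i' and q = "j' + 1" and m = m])
      (auto simp: lower_tri_def upper_tri_def)
  then show ?thesis by blast
qed

lemma tris_disjoint:
  assumes V: "V \<in> tris" and W: "W \<in> tris" and ne: "V \<noteq> W"
  shows "open_triangle V \<inter> open_triangle W = {}"
proof -
  have rows: "\<exists>m. (\<forall>x\<in>U. H m \<le> hco x \<and> hco x \<le> H (m + 1)) \<and>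
      (\<exists>i j. U = lower_tri m i j \<and> edge m i j \<and> edge m (i + 1) j \<or>
             U = upper_tri m i j \<and> edge m i j \<and> edge m i (j + 1))" if "U \<in> tris" for U
  proof -
    from that consider m i j where "U = lower_tri m i j" "edge m i j" "edge m (i + 1) j"
      | m i j where "U = upper_tri m i j" "edge m i j" "edge m i (j + 1)"
      unfolding tris_def by blast
    then show ?thesis
    proof cases
      case (1 m i j)
      have "\<forall>x\<in>U. H m \<le> hco x \<and> hco x \<le> H (m + 1)" using 1(1) by (simp add: lower_tri_def)
      then show ?thesis using 1 by blast
    next
      case (2 m i j)
      have "\<forall>x\<in>U. H m \<le> hco x \<and> hco x \<le> H (m + 1)" using 2(1) by (simp add: upper_tri_def)
      then show ?thesis using 2 by blast
    qed
  qed
  obtain m i j where m: "\<And>x. x \<in> V \<Longrightarrow> H m \<le> hco x \<and> hco x \<le> H (m + 1)"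
    and Vc: "V = lower_tri m i j \<and> edge m i j \<and> edge m (i + 1) j \<or>
             V = upper_tri m i j \<and> edge m i j \<and> edge m i (j + 1)"
    using rows[OF V] by blast
  obtain n i' j' where n: "\<And>x. x \<in> W \<Longrightarrow> H n \<le> hco x \<and> hco x \<le> H (n + 1)"
    and Wc: "W = lower_tri n i' j' \<and> edge n i' j' \<and> edge n (i' + 1) j' \<or>
             W = upper_tri n i' j' \<and> edge n i' j' \<and> edge n i' (j' + 1)"
    using rows[OF W] by blast
  consider "m < n" | "n < m" | "m = n" by linarith
  then show ?thesis
  proof cases
    case 1
    then have le: "H (m + 1) \<le> H n" by simp
    show ?thesis
    proof (rule open_triangle_disjoint[where a = 0 and b = 1 and c = "H n"])
      show "0 * tco x + 1 * hco x \<le> H n" if "x \<in> V" for x using m[OF that] le by linarith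
      show "H n \<le> 0 * tco x + 1 * hco x" if "x \<in> W" for x using n[OF that] by linarith
    qed simp
  next
    case 2
    then have le: "H (n + 1) \<le> H m" by simp
    have "open_triangle W \<inter> open_triangle V = {}"
    proof (rule open_triangle_disjoint[where a = 0 and b = 1 and c = "H m"])
      show "0 * tco x + 1 * hco x \<le> H m" if "x \<in> W" for x using n[OF that] le by linarith
      show "H m \<le> 0 * tco x + 1 * hco x" if "x \<in> V" for x using m[OF that] by linarith
    qed simp
    then show ?thesis by blast
  next
    case 3
    note Wc = Wc[folded 3]
    from Vc Wc show ?thesis
    proof (elim disjE conjE)
      assume *: "V = lower_tri m i j" "edge m i j" "edge m (i + 1) j"
        "W = lower_tri m i' j'" "edge m i' j'" "edge m (i' + 1) j'"
      consider "i < i'" | "i' < i" | "i = i'" by linarith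
      then show ?thesis
      proof cases
        case 3
        then have "j = j'" using edge_chain[OF *(2,6)] edge_chain[OF *(5,3)] by simp
        then show ?thesis using ne 3 * by simp
      next
        case 1
        then show ?thesis using lower_lower_disjoint[OF *(2,5)] * by simp
      next
        case 2
        then show ?thesis using lower_lower_disjoint[OF *(5,2)] * by (simp add: Int_commute)
      qed
    next
      assume *: "V = upper_tri m i j" "edge m i j" "edge m i (j + 1)"
        "W = upper_tri m i' j'" "edge m i' j'" "edge m i' (j' + 1)"
      have "(i, j) \<noteq> (i', j')" using ne * by auto
      then consider "i < i' \<or> i = i' \<and> j < j'" | "i' < i \<or> i' = i \<and> j' < j" by fastforce
      then show ?thesis
      proof cases
        case 1
        then show ?thesis using upper_upper_disjoint[OF *(3,5)] * by simp
      next
        case 2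
        then show ?thesis using upper_upper_disjoint[OF *(6,2)] * by (simp add: Int_commute)
      qed
    next
      assume "V = lower_tri m i j" "edge m i j" "edge m (i + 1) j"
        "W = upper_tri m i' j'" "edge m i' j'" "edge m i' (j' + 1)"
      then show ?thesis using lower_upper_disjoint[of m i j i' j'] by simp
    next
      assume "V = upper_tri m i j" "edge m i j" "edge m i (j + 1)"
        "W = lower_tri m i' j'" "edge m i' j'" "edge m (i' + 1) j'"
      then show ?thesis using lower_upper_disjoint[of m i' j' i j] by (simp add: Int_commute)
    qed
  qed
qed

lemma row_below: "\<exists>m. H m \<le> h \<and> h < H (m + 1)"
proof -
  obtain a b where ab: "H a \<le> h" "h < H b" using H_lower H_upper by blast
  then have "a < b" by (metis H_less_iff le_less_trans)
  define N where "N = (LEAST k. h < H (a + int k))"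
  have ex: "h < H (a + int (nat (b - a)))" using \<open>a < b\<close> ab(2) by simp
  have N: "h < H (a + int N)" unfolding N_def by (rule LeastI) (rule ex)
  then have "N \<noteq> 0" using ab(1) by (intro notI) simp
  then have "\<not> h < H (a + int (N - 1))" unfolding N_def by (intro not_less_Least) simp
  moreover have "a + int (N - 1) + 1 = a + int N" using \<open>N \<noteq> 0\<close> by simp
  ultimately show ?thesis using N by (intro exI[of _ "a + int (N - 1)"]) simp
qed

text \<open>
  For a point at height \<open>H m + s * (H (m + 1) - H m)\<close> the edges are ordered along the parallel to the rows
  through it. The last edge \<open>(p, q)\<close> not to the right of the point is the one with maximal \<open>p + q\<close>; it
  and its successor bound a triangle that contains the point.
\<close>

lemma tris_cover: "\<exists>V\<in>tris. x \<in> convex hull V"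
proof -
  obtain m where m: "H m \<le> hco x" "hco x < H (m + 1)" using row_below by blast
  define s where "s = (hco x - H m) / (H (m + 1) - H m)"
  have s: "0 \<le> s" "s < 1" using m by (auto simp: s_def field_simps)
  have "s * (H (m + 1) - H m) = hco x - H m" using m by (simp add: s_def)
  then have hs: "hco x = (1 - s) * H m + s * H (m + 1)" by (simp add: algebra_simps)
  define e where "e p q = (1 - s) * pos m p + s * pos (m + 1) q" for p q
  define w where "w = (D m + D (m + 1)) / 2"
  have e_near: "\<bar>e p q - pos m p\<bar> \<le> w" "\<bar>e p q - pos (m + 1) q\<bar> \<le> w" if "edge m p q" for p q
  proof -
    have 1: "\<bar>pos m p - pos (m + 1) q\<bar> \<le> w" using edge_pos_diff[OF that] by (simp add: w_def)
    have "e p q - pos m p = - s * (pos m p - pos (m + 1) q)" by (simp add: e_def algebra_simps)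
    then have "\<bar>e p q - pos m p\<bar> = s * \<bar>pos m p - pos (m + 1) q\<bar>" using s by (simp add: abs_mult)
    also have "\<dots> \<le> 1 * w" using 1 s by (intro mult_mono) auto
    finally show "\<bar>e p q - pos m p\<bar> \<le> w" by simp
    have "e p q - pos (m + 1) q = (1 - s) * (pos m p - pos (m + 1) q)" by (simp add: e_def algebra_simps)
    then have "\<bar>e p q - pos (m + 1) q\<bar> = (1 - s) * \<bar>pos m p - pos (m + 1) q\<bar>" using s by (simp add: abs_mult)
    also have "\<dots> \<le> 1 * w" using 1 s by (intro mult_mono) auto
    finally show "\<bar>e p q - pos (m + 1) q\<bar> \<le> w" by simp
  qed
  define P where "P = (\<lambda>(p, q). edge m p q \<and> e p q \<le> tco x)"
  have "\<exists>p q. P (p, q)"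
  proof -
    define p where "p = \<lfloor>(tco x - w - off m) / D m\<rfloor>"
    have "of_int p \<le> (tco x - w - off m) / D m" by (simp add: p_def)
    then have "pos m p + w \<le> tco x" using D_pos[of m] by (simp add: pos_def field_simps)
    moreover obtain q where "edge m p q" using ex_edge_lower by blast
    moreover have "e p q \<le> pos m p + w" using e_near(1)[OF \<open>edge m p q\<close>] by linarith
    ultimately have "P (p, q)" by (simp add: P_def)
    then show ?thesis by blast
  qed
  then obtain p0 q0 where P0: "P (p0, q0)" by blast
  \<comment> \<open>The endpoints of an edge lie within \<open>w\<close> of \<open>e p q\<close>, so \<open>e p q \<le> tco x\<close> bounds both indices.\<close>
  define N where "N = \<lfloor>(tco x + w - off m) / D m\<rfloor> + \<lfloor>(tco x + w - off (m + 1)) / D (m + 1)\<rfloor>"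
  have bound: "p + q \<le> N" if "P (p, q)" for p q
  proof -
    have "pos m p \<le> tco x + w" "pos (m + 1) q \<le> tco x + w"
      using that e_near[of p q] unfolding P_def by auto
    then have "of_int p \<le> (tco x + w - off m) / D m" "of_int q \<le> (tco x + w - off (m + 1)) / D (m + 1)"
      using D_pos[of m] D_pos[of "m + 1"] by (simp_all add: pos_def field_simps)
    then show ?thesis unfolding N_def by (simp add: le_floor_iff add_mono)
  qed
  obtain p q where pq: "P (p, q)"
    and max: "\<And>p' q'. P (p', q') \<Longrightarrow> nat (N - (p + q)) \<le> nat (N - (p' + q'))"
    using ex_has_least_nat[of P "(p0, q0)" "\<lambda>(p, q). nat (N - (p + q))", OF P0] by auto
  have next_gt: "tco x < e p' q'" if "edge m p' q'" "p' + q' = p + q + 1" for p' q'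
  proof (rule ccontr)
    assume "\<not> tco x < e p' q'"
    then have "P (p', q')" using that by (simp add: P_def)
    then show False using max[of p' q'] bound[of p' q'] that(2) by auto
  qed
  have E: "edge m p q" and le: "e p q \<le> tco x" using pq by (auto simp: P_def)
  consider "edge m (p + 1) q" | "edge m p (q + 1)" using edge_successor[OF E] by blast
  then show ?thesis
  proof cases
    case 1
    have gt: "tco x < e (p + 1) q" using next_gt[OF 1] by simp
    have step: "e (p + 1) q = e p q + (1 - s) * D m" by (simp add: e_def pos_plus_1 pos_1_plus algebra_simps)
    define y where "y = (tco x - e p q) / D m"
    have y: "0 \<le> y" "y \<le> 1 - s" "y * D m = tco x - e p q"
      using gt step le D_pos[of m] by (auto simp: y_def field_simps)
    have "x = (1 - s - y) *\<^sub>R X m p + y *\<^sub>R X m (p + 1) + s *\<^sub>R X (m + 1) q"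
      by (rule coords_eqI) (use y(3) hs in \<open>simp_all add: pos_plus_1 pos_1_plus e_def algebra_simps\<close>)
    then have "x \<in> convex hull lower_tri m p q"
      using y s unfolding lower_tri_def convex_hull_3
      by (intro CollectI exI[of _ "1 - s - y"] exI[of _ y] exI[of _ s]) auto
    then show ?thesis using E 1 unfolding tris_def by blast
  next
    case 2
    have gt: "tco x < e p (q + 1)" using next_gt[OF 2] by simp
    have step: "e p (q + 1) = e p q + s * D (m + 1)" by (simp add: e_def pos_plus_1 pos_1_plus algebra_simps)
    define y where "y = (tco x - e p q) / D (m + 1)"
    have y: "0 \<le> y" "y \<le> s" "y * D (m + 1) = tco x - e p q"
      using gt step le D_pos[of "m + 1"] by (auto simp: y_def field_simps)
    have "x = (1 - s) *\<^sub>R X m p + (s - y) *\<^sub>R X (m + 1) q + y *\<^sub>R X (m + 1) (q + 1)"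
      by (rule coords_eqI) (use y(3) hs in \<open>simp_all add: pos_plus_1 pos_1_plus e_def algebra_simps\<close>)
    then have "x \<in> convex hull upper_tri m p q"
      using y s unfolding upper_tri_def convex_hull_3
      by (intro CollectI exI[of _ "1 - s"] exI[of _ "s - y"] exI[of _ y]) auto
    then show ?thesis using E 2 unfolding tris_def by blast
  qed
qed

lemma tris_triangulation: "triangulation_of points tris"
proof -
  have "V \<subseteq> points \<and> card V = 3 \<and> \<not> collinear V" if "V \<in> tris" for V
    using that triangle_card triangle_not_collinear
    by (auto simp: tris_def points_def lower_tri_def upper_tri_def)
  then show ?thesis
    using tris_disjoint tris_cover by (simp add: triangulation_of_def set_eq_iff)
qed

lemma tris_ties: "ties_in tris"
  unfolding ties_in_def
proof (intro allI impI)
  fix m i j assume eq: "mid m i = mid (m + 1) j"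
  have "edge m i j \<and> edge m i (j + 1)" unfolding edge_upper_iff by (simp flip: eq)
  moreover have "edge m i (j + 1) \<and> edge m (i + 1) (j + 1)" unfolding edge_lower_iff by (simp add: eq)
  ultimately show "upper_tri m i j \<in> tris \<and> lower_tri m i (j + 1) \<in> tris"
    unfolding tris_def by blast
qed

section \<open>Uniqueness of the Delaunay triangulation\<close>

text \<open>The inequalities are not strict here, so that both diagonals of a concyclic quadrilateral occur.\<close>

lemma delaunay_triangle_cases:
  assumes VL: "V \<subseteq> points" and card: "card V = 3" and nc: "\<not> collinear V"
    and sph: "V \<subseteq> sphere c r" and empty: "ball c r \<inter> points = {}"
  obtains m i j where "V = lower_tri m i j" "mid (m + 1) (j - 1) \<le> mid m i" "mid m i \<le> mid (m + 1) j"
  | m i j where "V = upper_tri m i j" "mid m (i - 1) \<le> mid (m + 1) j" "mid (m + 1) j \<le> mid m i"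
proof -
  note cases = that
  define t where "t = tco c"
  define h where "h = hco c"
  have on: "(pos m i - t)\<^sup>2 + (H m - h)\<^sup>2 = r\<^sup>2" if "X m i \<in> V" for m i
    using sph that dist_X_sq[of c m i] unfolding t_def h_def by auto
  have "V \<noteq> {}" using card by auto
  then have r: "0 \<le> r" using sph by (metis ex_in_conv mem_sphere subsetD zero_le_dist)
  have out: "r\<^sup>2 \<le> (pos m i - t)\<^sup>2 + (H m - h)\<^sup>2" for m i
  proof -
    have "X m i \<notin> ball c r" using empty unfolding points_def by blast
    then have "r \<le> dist c (X m i)" by simp
    then show ?thesis using power_mono[OF _ r, of "dist c (X m i)" 2] dist_X_sq[of c m i] unfolding t_def h_def by simp
  qed
  have rows: "n \<le> m + 1" if "X m i \<in> V" "X n j \<in> V" for m n i j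
  proof (rule ccontr)
    assume "\<not> n \<le> m + 1"
    then have n: "H (m + 2) \<le> H n" by simp
    obtain l where "\<bar>pos (m + 1) l - t\<bar> \<le> D (m + 1) / 2" using nearest_point by blast
    then have "(pos (m + 1) l - t)\<^sup>2 \<le> (D (m + 1) / 2)\<^sup>2"
      using abs_le_square_iff D_pos[of "m + 1"] by fastforce
    then have k: "r\<^sup>2 \<le> (D (m + 1))\<^sup>2 / 4 + (H (m + 1) - h)\<^sup>2"
      using out[of "m + 1" l] by (simp add: power_divide)
    \<comment> \<open>The power of the circle, as a function of the height, is a monic quadratic that is nonpositive at
      rows \<open>m\<close> and \<open>n\<close>, hence at most \<open>- P * Q\<close> at row \<open>m + 1\<close>.\<close>
    define P where "P = H (m + 1) - H m"
    define Q where "Q = H n - H (m + 1)"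
    have P: "0 < P" by (simp add: P_def)
    have Q: "H (m + 2) - H (m + 1) \<le> Q" "0 < Q" using n \<open>\<not> n \<le> m + 1\<close> by (simp_all add: Q_def)
    have "(D (m + 1))\<^sup>2 / 4 < P * (H (m + 2) - H (m + 1))"
      using gap[of "m + 1"] by (simp add: P_def add.commute)
    also have "\<dots> \<le> P * Q" using P Q by (intro mult_left_mono) auto
    finally have PQ: "(D (m + 1))\<^sup>2 / 4 < P * Q" .
    have "(H m - h)\<^sup>2 \<le> r\<^sup>2" "(H n - h)\<^sup>2 \<le> r\<^sup>2"
      using on[OF that(1)] on[OF that(2)] zero_le_power2[of "pos m i - t"] zero_le_power2[of "pos n j - t"]
      by linarith+
    then have "Q * (H m - h)\<^sup>2 + P * (H n - h)\<^sup>2 \<le> Q * r\<^sup>2 + P * r\<^sup>2"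
      using P Q by (intro add_mono mult_left_mono) auto
    moreover have "Q * (H m - h)\<^sup>2 + P * (H n - h)\<^sup>2 = (P + Q) * ((H (m + 1) - h)\<^sup>2 + P * Q)"
      by (simp add: P_def Q_def power2_eq_square algebra_simps)
    ultimately have "(P + Q) * ((H (m + 1) - h)\<^sup>2 + P * Q) \<le> (P + Q) * r\<^sup>2"
      by (simp add: algebra_simps)
    then have "(H (m + 1) - h)\<^sup>2 + P * Q \<le> r\<^sup>2" using P Q by simp
    then show False using k PQ by linarith
  qed
  have pair: "j = i + 1 \<and> t = mid m i" if V: "X m i \<in> V" "X m j \<in> V" and less: "i < j" for m i j
  proof -
    have "(pos m i - t)\<^sup>2 = (pos m j - t)\<^sup>2" using on[OF V(1)] on[OF V(2)] by simp
    then have "(pos m i - pos m j) * (pos m i + pos m j - 2 * t) = 0"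
      by (simp add: power2_eq_square algebra_simps)
    then have t: "2 * t = pos m i + pos m j" using less by auto
    have "j = i + 1"
    proof (rule ccontr)
      \<comment> \<open>The point \<open>i + 1\<close> would lie strictly inside the chord, hence inside the circle.\<close>
      assume "j \<noteq> i + 1"
      then have "i + 1 < j" using less by simp
      then have "0 < (pos m (i + 1) - pos m i) * (pos m j - pos m (i + 1))"
        by (intro mult_pos_pos) (simp_all add: less_diff_eq)
      also have "\<dots> = (pos m i - t)\<^sup>2 - (pos m (i + 1) - t)\<^sup>2"
        unfolding power2_eq_square using t by algebra
      finally show False using on[OF V(1)] out[of m "i + 1"] by linarith
    qed
    then show ?thesis using t by (simp add: mid_eq_pos pos_plus_1)
  qed
  have near: "mid m (j - 1) \<le> t \<and> t \<le> mid m j" if "X m j \<in> V" for m j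
  proof -
    have "(pos m j - t)\<^sup>2 \<le> (pos m (j + 1) - t)\<^sup>2" "(pos m j - t)\<^sup>2 \<le> (pos m (j - 1) - t)\<^sup>2"
      using on[OF that] out[of m "j + 1"] out[of m "j - 1"] by linarith+
    moreover have "pos m (j - 1) = pos m j - D m" using pos_plus_1[of m "j - 1"] by simp
    ultimately have "0 \<le> D m * (D m + 2 * (pos m j - t))" "0 \<le> D m * (D m - 2 * (pos m j - t))"
      by (simp_all add: pos_plus_1 pos_1_plus power2_eq_square algebra_simps)
    then show ?thesis using D_pos[of m] unfolding mid_pred_eq_pos
      unfolding mid_eq_pos by (simp add: zero_le_mult_iff)
  qed
  have two_one: thesis if V: "V = {X m i, X m j, X n k}" and "i < j" for m n i j k
  proof -
    have "n \<noteq> m"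
    proof
      assume n: "n = m"
      have "collinear V" unfolding collinear_def
      proof (intro exI[of _ "pt 1 0"] ballI)
        fix x y assume "x \<in> V" "y \<in> V"
        then have "x - y = (tco x - tco y) *\<^sub>R pt 1 0" using V n by (intro coords_eqI) auto
        then show "\<exists>c. x - y = c *\<^sub>R pt 1 0" by blast
      qed
      then show False using nc by simp
    qed
    have mem: "X m i \<in> V" "X m j \<in> V" "X n k \<in> V" using V by simp_all
    have t: "j = i + 1" "t = mid m i" using pair[OF mem(1,2) \<open>i < j\<close>] by auto
    have "n \<le> m + 1" "m \<le> n + 1" using rows mem by blast+
    then consider "n = m + 1" | "m = n + 1" using \<open>n \<noteq> m\<close> by linarith
    then show thesis
    proof cases
      case 1
      have "V = lower_tri m i k" using V t 1 by (simp add: lower_tri_def)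
      then show thesis using cases(1) near[OF mem(3)] t 1 by metis
    next
      case 2
      have "V = upper_tri n k i" using V t 2 by (auto simp: upper_tri_def)
      then show thesis using cases(2) near[OF mem(3)] t 2 by metis
    qed
  qed
  have two_one': thesis if V: "V = {X m i, X m j, X n k}" and "i \<noteq> j" for m n i j k
    using two_one[OF V] two_one[of m j i n k] V \<open>i \<noteq> j\<close> by (metis insert_commute linorder_neqE)
  obtain x y z where xyz: "V = {x, y, z}" "x \<noteq> y" "x \<noteq> z" "y \<noteq> z" using card by (auto simp: card_3_iff)
  obtain a i b j e k where X: "x = X a i" "y = X b j" "z = X e k"
    using VL xyz(1) unfolding points_def by auto
  have mem: "X a i \<in> V" "X b j \<in> V" "X e k \<in> V" using xyz(1) X by simp_all
  have "a = b \<or> a = e \<or> b = e"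
    using rows[OF mem(1,2)] rows[OF mem(2,1)] rows[OF mem(1,3)] rows[OF mem(3,1)] rows[OF mem(2,3)] rows[OF mem(3,2)]
    by linarith
  then show thesis
  proof (elim disjE)
    assume "a = b"
    then show thesis using two_one'[of a i j e k] xyz X by simp
  next
    assume "a = e"
    then show thesis using two_one'[of a i k b j] xyz X by (simp add: insert_commute)
  next
    assume "b = e"
    then show thesis using two_one'[of b j k a i] xyz X by (simp add: insert_commute)
  qed
qed

lemma lower_upper_overlap:
  "open_triangle (lower_tri m i j) \<inter> open_triangle (upper_tri m i j) \<noteq> {}"
proof -
  have l: "lower_tri m i j = {X m i, X m i + D m *\<^sub>R pt 1 0, X (m + 1) j}"
    unfolding lower_tri_def by (intro arg_cong2[where f = insert] coords_eqI refl) (simp_all add: pos_plus_1)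
  have u: "upper_tri m i j = {X m i, X (m + 1) j, X (m + 1) j + D (m + 1) *\<^sub>R pt 1 0}"
    unfolding upper_tri_def by (intro arg_cong2[where f = insert] coords_eqI refl) (simp_all add: pos_plus_1)
  show ?thesis
    using triangle_not_collinear[of m i j] D_pos unfolding l u by (intro open_triangle_overlap) auto
qed

lemma lower_upper_overlap_Suc:
  "open_triangle (lower_tri m i (j + 1)) \<inter> open_triangle (upper_tri m (i + 1) j) \<noteq> {}"
proof -
  have l: "lower_tri m i (j + 1) = {X m (i + 1), X m (i + 1) + D m *\<^sub>R pt (- 1) 0, X (m + 1) (j + 1)}"
  proof -
    have "X m i = X m (i + 1) + D m *\<^sub>R pt (- 1) 0" by (intro coords_eqI) (simp_all add: pos_plus_1)
    then show ?thesis unfolding lower_tri_def by (metis insert_commute)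
  qed
  have u: "upper_tri m (i + 1) j =
      {X m (i + 1), X (m + 1) (j + 1), X (m + 1) (j + 1) + D (m + 1) *\<^sub>R pt (- 1) 0}"
  proof -
    have "X (m + 1) j = X (m + 1) (j + 1) + D (m + 1) *\<^sub>R pt (- 1) 0"
      by (intro coords_eqI) (simp_all add: pos_plus_1)
    then show ?thesis unfolding upper_tri_def by (metis insert_commute)
  qed
  show ?thesis
    using triangle_not_collinear(1)[of m i "j + 1"] triangle_not_collinear(2)[of m "i + 1" j] D_pos
    unfolding l u by (intro open_triangle_overlap) auto
qed

lemma lower_tri_neq_upper_tri: "lower_tri m i j \<noteq> upper_tri m i' j'"
proof
  assume "lower_tri m i j = upper_tri m i' j'"
  moreover have "X m i \<in> lower_tri m i j" "X m (i + 1) \<in> lower_tri m i j"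
    by (simp_all add: lower_tri_def)
  ultimately have "X m i \<in> upper_tri m i' j'" "X m (i + 1) \<in> upper_tri m i' j'" by simp_all
  then show False by (simp add: upper_tri_def)
qed

lemma tris_pair_cases:
  assumes "V \<in> tris" "x \<in> V" "y \<in> V" "x \<noteq> y"
  obtains m i j where "x = X m i" "y = X m j" "\<bar>i - j\<bar> = 1"
  | m i j where "edge m i j" "x = X m i \<and> y = X (m + 1) j \<or> y = X m i \<and> x = X (m + 1) j"
proof -
  from assms(1) consider m i j where "V = lower_tri m i j" "edge m i j" "edge m (i + 1) j"
    | m i j where "V = upper_tri m i j" "edge m i j" "edge m i (j + 1)"
    unfolding tris_def by blast
  then show thesis
  proof cases
    case (1 m i j)
    show thesis using assms(2-) unfolding 1(1) lower_tri_def
      using that(1)[of m i "i + 1"] that(1)[of m "i + 1" i] that(2)[OF 1(2)] that(2)[OF 1(3)] by auto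
  next
    case (2 m i j)
    show thesis using assms(2-) unfolding 2(1) upper_tri_def
      using that(1)[of "m + 1" j "j + 1"] that(1)[of "m + 1" "j + 1" j] that(2)[OF 2(2)] that(2)[OF 2(3)] by auto
  qed
qed

lemma delaunay_triangulation_unique:
  assumes T: "triangulation_of points T" and D: "delaunay points T" and ties: "ties_in T"
  shows "T = tris"
proof (rule triangulation_subset_eq[OF T tris_triangulation], rule subsetI)
  fix V assume V: "V \<in> T"
  have no_overlap: "V = W" if "W \<in> T" "open_triangle V \<inter> open_triangle W \<noteq> {}" for W
    using T V that unfolding triangulation_of_def by metis
  have "V \<subseteq> points" "card V = 3" "\<not> collinear V" using T V by (auto simp: triangulation_of_def)
  moreover obtain c r where "V \<subseteq> sphere c r" "ball c r \<inter> points = {}"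
    using D V unfolding delaunay_def by blast
  ultimately show "V \<in> tris"
  proof (cases rule: delaunay_triangle_cases)
    case (1 m i j)
    have "mid m i \<noteq> mid (m + 1) j"
    proof
      assume "mid m i = mid (m + 1) j"
      then have "upper_tri m i j \<in> T" using ties by (simp add: ties_in_def)
      then show False using no_overlap lower_upper_overlap lower_tri_neq_upper_tri 1(1) by metis
    qed
    then have "edge m i j \<and> edge m (i + 1) j" unfolding edge_lower_iff using 1 by simp
    then show ?thesis unfolding tris_def using 1(1) by blast
  next
    case (2 m i j)
    have "mid m (i - 1) \<noteq> mid (m + 1) j"
    proof
      assume "mid m (i - 1) = mid (m + 1) j"
      then have "lower_tri m (i - 1) (j + 1) \<in> T" using ties by (simp add: ties_in_def)
      moreover have "open_triangle V \<inter> open_triangle (lower_tri m (i - 1) (j + 1)) \<noteq> {}"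
        using lower_upper_overlap_Suc[of m "i - 1" j] 2(1) by (simp add: Int_commute)
      ultimately show False using no_overlap lower_tri_neq_upper_tri 2(1) by metis
    qed
    then have "edge m i j \<and> edge m i (j + 1)" unfolding edge_upper_iff using 2 by simp
    then show ?thesis unfolding tris_def using 2(1) by blast
  qed
qed

end

section \<open>Closed strips and sums over bonds\<close>

lemma closure_Omega:
  assumes "1 \<le> k"
  shows "closure (Omega k) = {x. 0 \<le> x $ 2 \<and> x $ 2 \<le> sqrt 3 / 2 * real k}"
proof
  have "closed {x :: real ^ 2. 0 \<le> x $ 2 \<and> x $ 2 \<le> sqrt 3 / 2 * real k}"
    by (intro closed_Collect_conj closed_Collect_le continuous_intros)
  then show "closure (Omega k) \<subseteq> {x. 0 \<le> x $ 2 \<and> x $ 2 \<le> sqrt 3 / 2 * real k}"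
    by (rule closure_minimal[rotated]) (auto simp: Omega_def)
  show "{x. 0 \<le> x $ 2 \<and> x $ 2 \<le> sqrt 3 / 2 * real k} \<subseteq> closure (Omega k)"
  proof
    fix x :: "real ^ 2"
    assume x: "x \<in> {x. 0 \<le> x $ 2 \<and> x $ 2 \<le> sqrt 3 / 2 * real k}"
    define c where "c = sqrt 3 / 2 * real k"
    have c: "0 < c" using assms by (simp add: c_def)
    \<comment> \<open>The segment from \<open>x\<close> to the point at half height lies in the open strip, except possibly for \<open>x\<close>.\<close>
    define z :: "real ^ 2" where "z = vector [x $ 1, c / 2]"
    have "(\<lambda>n. (1 - inverse (real (Suc n))) *\<^sub>R x + inverse (real (Suc n)) *\<^sub>R z) \<longlonglongrightarrow> (1 - 0) *\<^sub>R x + 0 *\<^sub>R z"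
      by (intro tendsto_intros LIMSEQ_inverse_real_of_nat)
    moreover have "(1 - inverse (real (Suc n))) *\<^sub>R x + inverse (real (Suc n)) *\<^sub>R z \<in> Omega k" for n
    proof -
      define e where "e = inverse (real (Suc n))"
      have e: "0 < e" "e \<le> 1" by (auto simp: e_def field_simps)
      have x': "0 \<le> x $ 2" "x $ 2 \<le> c" using x by (simp_all add: c_def)
      have "0 \<le> (1 - e) * x $ 2" "(1 - e) * x $ 2 \<le> (1 - e) * c" "0 < e * c"
        using e x' c by (auto intro: mult_left_mono)
      then show ?thesis
        unfolding e_def[symmetric] Omega_def c_def[symmetric] by (simp add: z_def algebra_simps)
    qed
    ultimately show "x \<in> closure (Omega k)"
      unfolding closure_sequential by (metis (no_types, lifting) diff_zero scaleR_one scaleR_zero_left add.right_neutral)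
  qed
qed

lemma infsum_ennreal_le_card:
  fixes f :: "'a \<Rightarrow> ennreal"
  assumes "finite F" "\<And>x. x \<in> S - F \<Longrightarrow> f x = 0" "\<And>x. x \<in> F \<Longrightarrow> f x \<le> c"
  shows "infsum f S \<le> of_nat (card F) * c"
proof -
  have "infsum f S \<le> infsum (\<lambda>_. c) F"
    using assms by (intro infsum_mono_neutral nonneg_summable_on_complete) auto
  then show ?thesis using assms(1) by simp
qed

lemma sum_le_infsum_ennreal:
  fixes f :: "'a \<Rightarrow> ennreal"
  assumes "finite F" "F \<subseteq> S"
  shows "sum f F \<le> infsum f S"
proof -
  have "infsum f F \<le> infsum f S" using assms by (intro infsum_mono_neutral nonneg_summable_on_complete) auto
  then show ?thesis using assms(1) by simp
qed

section \<open>The bilattice as a layered point set\<close>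

text \<open>
  The row of points with first lattice coordinate \<open>m\<close> (\<open>\<rho> * m\<close> on the right) is parallel to \<open>w2\<close>; its
  spacing is \<open>1\<close> on the left of the interface and \<open>\<rho>\<close> on the right. The points \<open>Ppt i\<close> form row \<open>-1\<close>
  and the points \<open>Qpt \<rho> j\<close> form row \<open>0\<close>. The offset is the tangential coordinate of the point of the row
  with second lattice coordinate \<open>0\<close>.
\<close>

definition row_scale :: "real \<Rightarrow> int \<Rightarrow> real" where
  "row_scale \<rho> m = (if m < 0 then 1 else \<rho>)"

definition row_height :: "real \<Rightarrow> int \<Rightarrow> real" where
  "row_height \<rho> m = sqrt 3 / 2 * (row_scale \<rho> m * of_int m)"

definition row_offset :: "real \<Rightarrow> int \<Rightarrow> real" where
  "row_offset \<rho> m = row_scale \<rho> m * of_int m / 2"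

lemma coords_w [simp]: "tco w1 = 1 / 2" "hco w1 = sqrt 3 / 2" "tco w2 = 1" "hco w2 = 0"
  by (simp_all add: tco_def hco_def w1_def w2_def field_simps sqrt3)

context
  fixes \<rho> :: real
  assumes \<rho>: "0 < \<rho>" "\<rho> < 1"
begin

lemma layered_bilattice:
  "layered (row_height \<rho>) (row_scale \<rho>)"
proof
  let ?H = "row_height \<rho>"
  fix m :: int
  show pos: "0 < row_scale \<rho> m" using \<rho> by (simp add: row_scale_def)
  have step: "?H (n + 1) - ?H n = sqrt 3 / 2 * row_scale \<rho> n" for n
    by (cases "n < - 1"; cases "n = - 1") (auto simp: row_height_def row_scale_def algebra_simps)
  have "?H (m + 1) - ?H m > 0" unfolding step using pos by simp
  then show "?H m < ?H (m + 1)" by simp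
  have pred: "?H m - ?H (m - 1) = sqrt 3 / 2 * row_scale \<rho> (m - 1)" using step[of "m - 1"] by simp
  have "(?H m - ?H (m - 1)) * (?H (m + 1) - ?H m) = 3 / 4 * (row_scale \<rho> (m - 1) * row_scale \<rho> m)"
    unfolding pred step by (simp add: sqrt3)
  moreover have "row_scale \<rho> m * row_scale \<rho> m \<le> row_scale \<rho> (m - 1) * row_scale \<rho> m"
    using \<rho> by (auto simp: row_scale_def)
  moreover have "0 < row_scale \<rho> m * row_scale \<rho> m" using pos by simp
  ultimately show "(row_scale \<rho> m)\<^sup>2 / 4 < (?H m - ?H (m - 1)) * (?H (m + 1) - ?H m)"
    unfolding power2_eq_square by linarith
next
  let ?H = "row_height \<rho>"
  fix h :: real
  define m where "m = min (- 1) \<lfloor>2 * h / sqrt 3\<rfloor>"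
  have "of_int m \<le> 2 * h / sqrt 3" unfolding m_def by linarith
  moreover have "m < 0" by (simp add: m_def)
  ultimately have "?H m \<le> h" by (simp add: row_height_def row_scale_def field_simps)
  then show "\<exists>m. ?H m \<le> h" by blast
  define n where "n = max 0 (\<lfloor>2 * h / (sqrt 3 * \<rho>)\<rfloor> + 1)"
  have "2 * h / (sqrt 3 * \<rho>) < of_int n" unfolding n_def by linarith
  moreover have "\<not> n < 0" by (simp add: n_def)
  ultimately have "h < ?H n" using \<rho> by (simp add: row_height_def row_scale_def field_simps)
  then show "\<exists>m. h < ?H m" by blast
qed

interpretation L: layered "row_height \<rho>" "row_scale \<rho>" "row_offset \<rho>"
  by (rule layered_bilattice)

lemma row_scale_pos: "0 < row_scale \<rho> m"
  by (rule L.D_pos)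

lemma pos_eq: "L.pos m i = row_scale \<rho> m * (of_int m / 2 + of_int i)"
  by (simp add: L.pos_def row_offset_def algebra_simps)

lemma mid_eq: "L.mid m i = row_scale \<rho> m * (of_int m / 2 + of_int i + 1 / 2)"
  by (simp add: L.mid_def row_offset_def algebra_simps)

lemma X_eq: "L.X m i = row_scale \<rho> m *\<^sub>R (of_int m *\<^sub>R w1 + of_int i *\<^sub>R w2)"
  by (rule coords_eqI) (simp_all add: pos_eq row_height_def algebra_simps)

lemma X_minus_1: "L.X (- 1) i = Ppt i" and X_0: "L.X 0 j = Qpt \<rho> j"
  by (simp_all add: X_eq row_scale_def Ppt_def Qpt_def mult.commute)

lemma minus_eq: "lattice_minus = {L.X m i | m i. m < 0}"
  unfolding lattice_minus_def X_eq by (intro Collect_cong ex_cong1) (auto simp: row_scale_def)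

lemma plus_eq: "lattice_plus \<rho> = {L.X m i | m i. 0 \<le> m}"
  unfolding lattice_plus_def X_eq using \<rho>
  by (intro Collect_cong ex_cong1) (auto simp: row_scale_def scaleR_add_right zero_le_mult_iff)

lemma minus_X_iff: "L.X m i \<in> lattice_minus \<longleftrightarrow> m < 0"
  and plus_X_iff: "L.X m i \<in> lattice_plus \<rho> \<longleftrightarrow> 0 \<le> m"
  unfolding minus_eq plus_eq by auto

lemma points_eq: "L.points = bilattice \<rho>"
  unfolding L.points_def bilattice_def minus_eq plus_eq by auto

lemma concyclic_iff:
  "concyclic {Ppt i, Ppt (i + 1), Qpt \<rho> j, Qpt \<rho> (j + 1)} \<longleftrightarrow> L.mid (- 1) i = L.mid 0 j"
proof
  assume "concyclic {Ppt i, Ppt (i + 1), Qpt \<rho> j, Qpt \<rho> (j + 1)}"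
  then obtain c r where cr: "dist c (L.X (- 1) i) = r" "dist c (L.X (- 1) (i + 1)) = r"
    "dist c (L.X 0 j) = r" "dist c (L.X 0 (j + 1)) = r"
    unfolding concyclic_def X_minus_1[symmetric] X_0[symmetric] by auto
  have centre: "tco c = L.mid m k" if "dist c (L.X m k) = r" "dist c (L.X m (k + 1)) = r" for m k
  proof -
    have "(L.pos m k - tco c)\<^sup>2 = (L.pos m (k + 1) - tco c)\<^sup>2"
      using that L.dist_X_sq[of c m k] L.dist_X_sq[of c m "k + 1"] by simp
    then have "(L.pos m k - L.pos m (k + 1)) * (L.pos m k + L.pos m (k + 1) - 2 * tco c) = 0"
      by (simp add: power2_eq_square algebra_simps)
    then have "L.pos m k + L.pos m (k + 1) = 2 * tco c" by simp
    then show ?thesis by (simp add: L.mid_eq_pos L.pos_plus_1)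
  qed
  show "L.mid (- 1) i = L.mid 0 j" using centre cr by metis
next
  assume eq: "L.mid (- 1) i = L.mid 0 j"
  have "L.mid 0 (j - 1) \<le> L.mid (- 1) i" unfolding eq by simp
  then obtain c r where "L.lower_tri (- 1) i j \<subseteq> sphere c r" "L.X 0 (j + 1) \<in> sphere c r"
    using L.lower_tri_circle[of "- 1" j i] eq by auto
  then show "concyclic {Ppt i, Ppt (i + 1), Qpt \<rho> j, Qpt \<rho> (j + 1)}"
    unfolding concyclic_def X_minus_1[symmetric] X_0[symmetric] L.lower_tri_def
    by (intro exI[of _ c] exI[of _ r]) simp
qed

text \<open>Inside each of the two lattices adjacent rows are offset by half a spacing, so there are no ties.\<close>

lemma mid_neq:
  assumes "m \<noteq> - 1"
  shows "L.mid m i \<noteq> L.mid (m + 1) j"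
proof
  assume "L.mid m i = L.mid (m + 1) j"
  moreover have "row_scale \<rho> (m + 1) = row_scale \<rho> m" using assms by (simp add: row_scale_def)
  ultimately have "of_int m / 2 + of_int i + 1 / 2 = of_int (m + 1) / 2 + of_int j + (1 / 2 :: real)"
    unfolding mid_eq using row_scale_pos[of m] by simp
  then have "real_of_int (2 * i) = real_of_int (2 * j + 1)" by (simp add: field_simps)
  then have "2 * i = 2 * j + 1" by (simp only: of_int_eq_iff)
  then show False by presburger
qed

lemma tri_convention_iff: "tri_convention \<rho> T \<longleftrightarrow> L.ties_in T"
proof
  assume T: "tri_convention \<rho> T"
  show "L.ties_in T" unfolding L.ties_in_def
  proof (intro allI impI)
    fix m i j assume eq: "L.mid m i = L.mid (m + 1) j"
    then have m: "m = - 1" using mid_neq by blast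
    show "L.upper_tri m i j \<in> T \<and> L.lower_tri m i (j + 1) \<in> T"
      using T eq unfolding m tri_convention_def concyclic_iff L.upper_tri_def L.lower_tri_def
      by (simp add: X_minus_1 X_0)
  qed
next
  assume T: "L.ties_in T"
  show "tri_convention \<rho> T" unfolding tri_convention_def concyclic_iff
  proof (intro allI impI)
    fix i j assume "L.mid (- 1) i = L.mid 0 j"
    then have "L.upper_tri (- 1) i j \<in> T \<and> L.lower_tri (- 1) i (j + 1) \<in> T"
      using T unfolding L.ties_in_def by (metis add.left_inverse)
    then show "{Ppt i, Qpt \<rho> j, Qpt \<rho> (j + 1)} \<in> T \<and> {Ppt i, Ppt (i + 1), Qpt \<rho> (j + 1)} \<in> T"
      by (simp add: L.upper_tri_def L.lower_tri_def X_minus_1 X_0)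
  qed
qed

lemma tri_eq: "tri \<rho> = L.tris"
  unfolding tri_def points_eq[symmetric] tri_convention_iff
  by (intro the_equality conjI L.tris_triangulation L.tris_delaunay L.tris_ties)
    (elim conjE, rule L.delaunay_triangulation_unique)

lemma edge_minus_1_imp_NN:
  assumes "L.edge (- 1) i j" "L.edge (- 1) (i + 1) j"
  shows "NN \<rho> (Ppt i) (Qpt \<rho> j)" "NN \<rho> (Qpt \<rho> j) (Ppt i)"
proof -
  have "L.lower_tri (- 1) i j \<in> tri \<rho>" unfolding tri_eq L.tris_def using assms by blast
  moreover have "Ppt i \<in> L.lower_tri (- 1) i j" "Qpt \<rho> j \<in> L.lower_tri (- 1) i j"
    by (simp_all add: L.lower_tri_def X_minus_1 X_0)
  moreover have "Ppt i \<noteq> Qpt \<rho> j" unfolding X_minus_1[symmetric] X_0[symmetric] by simp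
  ultimately show "NN \<rho> (Ppt i) (Qpt \<rho> j)" "NN \<rho> (Qpt \<rho> j) (Ppt i)" unfolding NN_def by auto
qed

text \<open>Away from the interface the triangles are equilateral.\<close>

lemma norm_edge_same_scale:
  assumes "L.edge m i j" "m \<noteq> - 1"
  shows "norm (L.X m i - L.X (m + 1) j) = row_scale \<rho> m"
proof -
  have s: "row_scale \<rho> (m + 1) = row_scale \<rho> m" using assms(2) by (simp add: row_scale_def)
  have "of_int (m + 1) / 2 + of_int (j - 1) + 1 / 2 \<le> of_int m / 2 + of_int i + (1 / 2 :: real)"
       "of_int m / 2 + of_int (i - 1) + 1 / 2 < of_int (m + 1) / 2 + of_int j + (1 / 2 :: real)"
    using assms(1) row_scale_pos[of m] unfolding L.edge_def mid_eq s by simp_all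
  then have "real_of_int (2 * j) \<le> real_of_int (2 * i + 1)" "real_of_int (2 * i) < real_of_int (2 * j + 3)"
    by (simp_all add: field_simps)
  then have "2 * j \<le> 2 * i + 1" "2 * i < 2 * j + 3" by (simp_all only: of_int_le_iff of_int_less_iff)
  then have ij: "i = j \<or> i = j + 1" by presburger
  have diff: "tco (L.X m i - L.X (m + 1) j) = row_scale \<rho> m * (of_int (i - j) - 1 / 2)"
    "hco (L.X m i - L.X (m + 1) j) = - (row_scale \<rho> m * (sqrt 3 / 2))"
    unfolding L.tco_X L.hco_X tco_linear hco_linear pos_eq row_height_def s
    by (simp_all add: algebra_simps)
  have "(norm (L.X m i - L.X (m + 1) j))\<^sup>2 = (row_scale \<rho> m)\<^sup>2"
    unfolding norm_sq_coords diff using ij by (auto simp: power_mult_distrib power_divide)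
  then show ?thesis by (rule power2_eq_imp_eq) (simp_all add: row_scale_pos less_imp_le)
qed

lemma norm_same_row:
  assumes "\<bar>i - j\<bar> = 1"
  shows "norm (L.X m i - L.X m j) = row_scale \<rho> m"
proof -
  have "i = j + 1 \<or> j = i + 1" using assms by linarith
  then have "(norm (L.X m i - L.X m j))\<^sup>2 = (row_scale \<rho> m)\<^sup>2"
    unfolding norm_sq_coords by (auto simp: L.pos_plus_1)
  then show ?thesis by (rule power2_eq_imp_eq) (simp_all add: row_scale_pos less_imp_le)
qed

lemma NN_bilattice_cases:
  assumes "NN \<rho> x y"
  obtains "x \<in> lattice_minus" "y \<in> lattice_minus" "norm (x - y) = 1"
  | "x \<in> lattice_plus \<rho>" "y \<in> lattice_plus \<rho>" "norm (x - y) = \<rho>"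
  | i j where "L.edge (- 1) i j" "x = Ppt i" "y = Qpt \<rho> j"
  | i j where "L.edge (- 1) i j" "x = Qpt \<rho> j" "y = Ppt i"
proof -
  note cases = that
  have same: thesis if "norm (x - y) = row_scale \<rho> m" "x = L.X a i" "y = L.X b j"
      "a < 0 \<and> b < 0 \<and> m < 0 \<or> 0 \<le> a \<and> 0 \<le> b \<and> 0 \<le> m" for m a b i j
    using that cases(1,2) by (auto simp: minus_X_iff plus_X_iff row_scale_def split: if_splits)
  obtain V where V: "V \<in> L.tris" "x \<in> V" "y \<in> V" "x \<noteq> y"
    using assms unfolding NN_def tri_eq by blast
  then show thesis
  proof (cases rule: L.tris_pair_cases)
    case (1 m i j)
    have "norm (x - y) = row_scale \<rho> m" unfolding 1 by (rule norm_same_row[OF 1(3)])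
    then show thesis by (rule same[OF _ 1(1,2)]) linarith
  next
    case (2 m i j)
    show thesis
    proof (cases "m = - 1")
      case True
      then show thesis
        using 2(2) cases(3)[OF 2(1)[unfolded True]] cases(4)[OF 2(1)[unfolded True]]
        by (elim disjE conjE) (simp_all add: X_minus_1 X_0)
    next
      case False
      have n: "norm (x - y) = row_scale \<rho> m"
        using 2(2) norm_edge_same_scale[OF 2(1) False] norm_minus_commute[of x y] by metis
      from 2(2) show thesis
      proof (elim disjE conjE)
        assume "x = L.X m i" "y = L.X (m + 1) j"
        then show thesis by (rule same[OF n]) (use False in linarith)
      next
        assume "y = L.X m i" "x = L.X (m + 1) j"
        then show thesis by (intro same[OF n, of "m + 1" j m i]) (use False in linarith)+
      qed
    qed
  qed
qed

lemma norm_edge_minus_1: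
  assumes "L.edge (- 1) i j"
  shows "norm (Ppt i - Qpt \<rho> j) \<le> 2"
proof -
  have "\<bar>L.pos (- 1) i - L.pos 0 j\<bar> \<le> 1"
    using L.edge_pos_diff[OF assms] \<rho> by (simp add: row_scale_def)
  then have "(L.pos (- 1) i - L.pos 0 j)\<^sup>2 \<le> 1" by (simp add: abs_square_le_1)
  then have "(norm (L.X (- 1) i - L.X 0 j))\<^sup>2 \<le> 2\<^sup>2"
    unfolding norm_sq_coords by (simp add: row_height_def row_scale_def power2_eq_square sqrt3)
  then show ?thesis unfolding X_minus_1 X_0 by (rule power2_le_imp_le) simp
qed

section \<open>Bonds in the strip and the energy estimates\<close>

lemma Ppt_in_strip_iff:
  assumes "1 \<le> k"
  shows "Ppt i \<in> strip_minus k \<longleftrightarrow> 0 \<le> i \<and> i \<le> int k"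
proof -
  have "Ppt i \<in> lattice_minus" unfolding X_minus_1[symmetric] minus_X_iff by simp
  moreover have height: "Ppt i $ 2 = sqrt 3 / 2 * of_int i" by (simp add: Ppt_def w1_def w2_def)
  have "0 \<le> Ppt i $ 2 \<longleftrightarrow> 0 \<le> i" "Ppt i $ 2 \<le> sqrt 3 / 2 * real k \<longleftrightarrow> of_int i \<le> real k"
    unfolding height by (simp_all add: zero_le_mult_iff)
  moreover have "of_int i \<le> real k \<longleftrightarrow> i \<le> int k" by linarith
  ultimately show ?thesis
    unfolding strip_minus_def closure_Omega[OF assms] by simp
qed

lemma Qpt_in_strip_iff:
  assumes "1 \<le> k"
  shows "Qpt \<rho> j \<in> strip_plus \<rho> k \<longleftrightarrow> 0 \<le> j \<and> of_int j * \<rho> \<le> real k"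
proof -
  have "Qpt \<rho> j \<in> lattice_plus \<rho>" unfolding X_0[symmetric] plus_X_iff by simp
  moreover have height: "Qpt \<rho> j $ 2 = sqrt 3 / 2 * (of_int j * \<rho>)" by (simp add: Qpt_def w2_def)
  have "0 \<le> Qpt \<rho> j $ 2 \<longleftrightarrow> 0 \<le> j"
    "Qpt \<rho> j $ 2 \<le> sqrt 3 / 2 * real k \<longleftrightarrow> of_int j * \<rho> \<le> real k"
    unfolding height using \<rho> by (simp_all add: zero_le_mult_iff)
  ultimately show ?thesis
    unfolding strip_plus_def closure_Omega[OF assms] by simp
qed

lemma strip_eq: "strip \<rho> k = strip_minus k \<union> strip_plus \<rho> k"
  by (auto simp: strip_def strip_minus_def strip_plus_def bilattice_def)

lemma sublattices_disjoint: "lattice_minus \<inter> lattice_plus \<rho> = {}"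
  unfolding minus_eq plus_eq by auto

text \<open>The index pairs of the bonds of the strip that cross the interface.\<close>

definition crossing :: "nat \<Rightarrow> (int \<times> int) set" where
  "crossing k = {(i, j). L.edge (- 1) i j \<and> Ppt i \<in> strip_minus k \<and> Qpt \<rho> j \<in> strip_plus \<rho> k}"

text \<open>Crossing bonds form a chain, so each of them is determined by the sum of its two indices.\<close>

lemma crossing_card:
  assumes "1 \<le> k"
  shows "finite (crossing k)" "real (card (crossing k)) \<le> (2 + 1 / \<rho>) * real k"
proof -
  define N where "N = int k + \<lfloor>real k / \<rho>\<rfloor>"
  have inj: "inj_on (\<lambda>(i, j). i + j) (crossing k)"
    by (auto simp: inj_on_def crossing_def dest: L.edge_eqI)
  have sub: "(\<lambda>(i, j). i + j) ` crossing k \<subseteq> {0..N}"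
  proof -
    have "0 \<le> i + j \<and> i + j \<le> N" if "(i, j) \<in> crossing k" for i j
    proof -
      have ij: "0 \<le> i" "i \<le> int k" "0 \<le> j" "of_int j * \<rho> \<le> real k"
        using that by (simp_all add: crossing_def Ppt_in_strip_iff[OF assms] Qpt_in_strip_iff[OF assms])
      then have "of_int j \<le> real k / \<rho>" using \<rho> by (simp add: field_simps)
      then have "j \<le> \<lfloor>real k / \<rho>\<rfloor>" by (simp add: le_floor_iff)
      then show ?thesis using ij by (simp add: N_def)
    qed
    then show ?thesis by auto
  qed
  show "finite (crossing k)" by (rule inj_on_finite[OF inj sub]) simp
  have "0 \<le> real k / \<rho>" using \<rho> by simp
  then have N: "0 \<le> N" unfolding N_def by simp
  have "card (crossing k) \<le> card {0..N}" by (rule card_inj_on_le[OF inj sub]) simp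
  then have "real (card (crossing k)) \<le> of_int N + 1" using N by simp
  also have "\<dots> \<le> real k + real k / \<rho> + real k" unfolding N_def using assms by simp linarith
  also have "\<dots> = (2 + 1 / \<rho>) * real k" using \<rho> by (simp add: field_simps)
  finally show "real (card (crossing k)) \<le> (2 + 1 / \<rho>) * real k" .
qed

text \<open>
  Only crossing bonds contribute, and their length is at most \<open>2\<close>, so each summand is at most \<open>4\<close>.
\<close>

lemma energy_identity_le:
  assumes "1 \<le> k"
  shows "energy \<rho> \<rho> k (\<lambda>x. x) \<le> ennreal (4 * (2 + 1 / \<rho>) * real k)"
proof -
  let ?n = "card (crossing k)"
  define PQ where "PQ = (\<lambda>(i, j). (Ppt i, Qpt \<rho> j)) ` crossing k"
  define QP where "QP = (\<lambda>(i, j). (Qpt \<rho> j, Ppt i)) ` crossing k"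
  have card: "card PQ \<le> ?n" "card QP \<le> ?n" and fin: "finite PQ" "finite QP"
    unfolding PQ_def QP_def using crossing_card(1)[OF assms] by (simp_all add: card_image_le)
  have len: "(norm (x - y) - a)\<^sup>2 \<le> 4" if xy: "(x, y) \<in> PQ \<union> QP" and a: "0 \<le> a" "a \<le> 1" for x y a
  proof -
    obtain i j where "L.edge (- 1) i j" "norm (x - y) = norm (Ppt i - Qpt \<rho> j)"
      using xy by (auto simp: PQ_def QP_def crossing_def norm_minus_commute)
    then have "norm (x - y) \<le> 2" using norm_edge_minus_1 by simp
    then have "\<bar>norm (x - y) - a\<bar> \<le> 2" using a norm_ge_zero[of "x - y"] by linarith
    then show ?thesis using abs_le_square_iff[of "norm (x - y) - a" 2] by simp
  qed
  have scal: "of_nat (card F) * ennreal 4 \<le> ennreal (4 * real ?n)" if "card F \<le> ?n" for F :: "((real ^ 2) \<times> (real ^ 2)) set"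
  proof -
    have "of_nat (card F) * ennreal 4 = ennreal (real (card F) * 4)"
      by (simp add: ennreal_mult ennreal_of_nat_eq_real_of_nat)
    then show ?thesis using that by (simp add: ennreal_leI)
  qed
  have "infsum (\<lambda>(x, y). ennreal ((norm (x - y) - 1)\<^sup>2))
      {(x, y). NN \<rho> x y \<and> x \<in> strip_minus k \<and> y \<in> strip \<rho> k} \<le> of_nat (card PQ) * ennreal 4"
  proof (rule infsum_ennreal_le_card[OF fin(1)])
    fix p assume p: "p \<in> {(x, y). NN \<rho> x y \<and> x \<in> strip_minus k \<and> y \<in> strip \<rho> k} - PQ"
    obtain x y where xy: "p = (x, y)" by (cases p)
    have nn: "NN \<rho> x y" and x: "x \<in> strip_minus k" and y: "y \<in> strip \<rho> k" and nPQ: "(x, y) \<notin> PQ"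
      using p xy by auto
    have xm: "x \<in> lattice_minus" using x by (simp add: strip_minus_def)
    from nn have "norm (x - y) = 1"
    proof (cases rule: NN_bilattice_cases)
      case (3 i j)
      have "y \<in> strip_plus \<rho> k"
        using y 3 by (simp add: strip_def strip_plus_def plus_X_iff flip: X_0)
      then have "(i, j) \<in> crossing k" using 3 x by (simp add: crossing_def)
      then show ?thesis using nPQ 3 unfolding PQ_def by (metis (mono_tags, lifting) case_prod_conv imageI)
    next
      case (4 i j)
      then have "x \<in> lattice_plus \<rho>" by (simp add: plus_X_iff flip: X_0)
      then show ?thesis using xm sublattices_disjoint by blast
    qed (use xm sublattices_disjoint in auto)
    then show "(case p of (x, y) \<Rightarrow> ennreal ((norm (x - y) - 1)\<^sup>2)) = 0" using xy by simp
  qed (use len[where a = 1] in \<open>auto simp: ennreal_leI split: prod.splits simp flip: ennreal_numeral\<close>)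
  then have 1: "infsum (\<lambda>(x, y). ennreal ((norm (x - y) - 1)\<^sup>2))
      {(x, y). NN \<rho> x y \<and> x \<in> strip_minus k \<and> y \<in> strip \<rho> k} \<le> ennreal (4 * real ?n)"
    using scal[OF card(1)] by (rule order_trans)
  have "infsum (\<lambda>(x, y). ennreal ((norm (x - y) - \<rho>)\<^sup>2))
      {(x, y). NN \<rho> x y \<and> x \<in> strip_plus \<rho> k \<and> y \<in> strip \<rho> k} \<le> of_nat (card QP) * ennreal 4"
  proof (rule infsum_ennreal_le_card[OF fin(2)])
    fix p assume p: "p \<in> {(x, y). NN \<rho> x y \<and> x \<in> strip_plus \<rho> k \<and> y \<in> strip \<rho> k} - QP"
    obtain x y where xy: "p = (x, y)" by (cases p)
    have nn: "NN \<rho> x y" and x: "x \<in> strip_plus \<rho> k" and y: "y \<in> strip \<rho> k" and nQP: "(x, y) \<notin> QP"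
      using p xy by auto
    have xp: "x \<in> lattice_plus \<rho>" using x by (simp add: strip_plus_def)
    from nn have "norm (x - y) = \<rho>"
    proof (cases rule: NN_bilattice_cases)
      case (3 i j)
      then have "x \<in> lattice_minus" by (simp add: minus_X_iff flip: X_minus_1)
      then show ?thesis using xp sublattices_disjoint by blast
    next
      case (4 i j)
      have "y \<in> strip_minus k"
        using y 4 by (simp add: strip_def strip_minus_def minus_X_iff flip: X_minus_1)
      then have "(i, j) \<in> crossing k" using 4 x by (simp add: crossing_def)
      then show ?thesis using nQP 4 unfolding QP_def by (metis (mono_tags, lifting) case_prod_conv imageI)
    qed (use xp sublattices_disjoint in auto)
    then show "(case p of (x, y) \<Rightarrow> ennreal ((norm (x - y) - \<rho>)\<^sup>2)) = 0" using xy by simp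
  qed (use len[where a = \<rho>] \<rho> in \<open>auto simp: ennreal_leI split: prod.splits simp flip: ennreal_numeral\<close>)
  then have 2: "infsum (\<lambda>(x, y). ennreal ((norm (x - y) - \<rho>)\<^sup>2))
      {(x, y). NN \<rho> x y \<and> x \<in> strip_plus \<rho> k \<and> y \<in> strip \<rho> k} \<le> ennreal (4 * real ?n)"
    using scal[OF card(2)] by (rule order_trans)
  have "energy \<rho> \<rho> k (\<lambda>x. x) \<le> ennreal (1 / 2) * ennreal (4 * real ?n) + ennreal (1 / 2) * ennreal (4 * real ?n)"
    unfolding energy_def using 1 2 by (intro add_mono mult_left_mono) auto
  also have "\<dots> = ennreal (4 * real ?n)"
  proof -
    have "ennreal (1 / 2) * ennreal (4 * real ?n) = ennreal (2 * real ?n)"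
      by (subst ennreal_mult[symmetric]) simp_all
    then show ?thesis by (simp flip: ennreal_plus)
  qed
  also have "\<dots> \<le> ennreal (4 * (2 + 1 / \<rho>) * real k)"
    using crossing_card(2)[OF assms]
    by (intro ennreal_leI) (simp only: mult.assoc mult_le_cancel_left_pos zero_less_numeral)
  finally show ?thesis .
qed

lemma identity_competitor: "(\<lambda>x. x) \<in> competitors \<rho> \<rho> k"
proof -
  have "\<exists>(A :: real ^ 2 ^ 2) b. \<forall>x\<in>Omega k \<inter> open_triangle V. x = A *v x + b" for V
    by (intro exI[of _ "mat 1"] exI[of _ 0]) simp
  moreover have "det (jacobian (\<lambda>x :: real ^ 2. x) (at x)) = 1" for x
    by (simp add: jacobian_def matrix_id_mat_1[unfolded id_def])
  ultimately have "(\<lambda>x. x) \<in> admissible \<rho> k" unfolding admissible_def by (simp add: continuous_on_id)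
  moreover have "(\<lambda>h. (\<rho> / \<rho>) *\<^sub>R h) = (\<lambda>h :: real ^ 2. h)" using \<rho> by simp
  ultimately show ?thesis
    unfolding competitors_def by (auto intro!: exI[of _ 1] simp del: divide_self_if)
qed

lemma transition_cost_le:
  assumes "1 \<le> k"
  shows "transition_cost \<rho> \<rho> k \<le> ennreal (4 * (2 + 1 / \<rho>) * real k)"
  unfolding transition_cost_def
  using INF_lower[OF identity_competitor] energy_identity_le[OF assms] by (rule order_trans)

text \<open>
  The bound holds for every map: for each \<open>i\<close> the bond from \<open>Ppt i\<close> to the third vertex \<open>Qpt \<rho> (q i)\<close>
  of the triangle on the segment from \<open>Ppt i\<close> to \<open>Ppt (i + 1)\<close> is counted with both rest lengths.
\<close>

lemma energy_ge:
  assumes "1 \<le> k"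
  shows "ennreal ((1 - \<rho>)\<^sup>2 / 4 * real k) \<le> energy \<rho> \<rho> k u"
proof -
  obtain q where q: "\<And>i. L.edge (- 1) i (q i)" "\<And>i. L.edge (- 1) (i + 1) (q i)"
    using L.ex_edge_lower by metis
  have in_strip: "Ppt i \<in> strip_minus k" "Qpt \<rho> (q i) \<in> strip_plus \<rho> k" if "0 \<le> i" "i < int k" for i
  proof -
    show "Ppt i \<in> strip_minus k" using that by (simp add: Ppt_in_strip_iff[OF assms])
    have "L.mid 0 (q i - 1) \<le> L.mid (- 1) i" "L.mid (- 1) i < L.mid 0 (q i)"
      using q L.edge_lower_iff[of "- 1" i "q i"] by simp_all
    then have *: "\<rho> * (of_int (q i) - 1 / 2) \<le> of_int i" "of_int i < \<rho> * (of_int (q i) + 1 / 2)"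
      unfolding mid_eq by (simp_all add: row_scale_def algebra_simps)
    have "0 < \<rho> * (of_int (q i) + 1 / 2)" using *(2) that(1) by linarith
    then have "0 < of_int (q i) + (1 / 2 :: real)" using \<rho> by (simp add: zero_less_mult_iff)
    then have "0 \<le> q i" by linarith
    moreover have "of_int (q i) * \<rho> \<le> of_int i + 1" using *(1) \<rho> by (simp add: algebra_simps)
    moreover have "of_int i + 1 \<le> real k" using that(2) by linarith
    ultimately show "Qpt \<rho> (q i) \<in> strip_plus \<rho> k" by (simp add: Qpt_in_strip_iff[OF assms])
  qed
  define I where "I = {0..<int k}"
  define d where "d i = norm (u (Ppt i) - u (Qpt \<rho> (q i)))" for i
  have inj: "inj Ppt" by (rule injI) (simp flip: X_minus_1)
  have "(\<Sum>i\<in>I. ennreal ((d i - 1)\<^sup>2)) =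
      (\<Sum>p\<in>(\<lambda>i. (Ppt i, Qpt \<rho> (q i))) ` I. case p of (x, y) \<Rightarrow> ennreal ((norm (u x - u y) - 1)\<^sup>2))"
    by (subst sum.reindex) (auto simp: inj_on_def d_def dest: injD[OF inj])
  also have "\<dots> \<le> infsum (\<lambda>(x, y). ennreal ((norm (u x - u y) - 1)\<^sup>2))
       {(x, y). NN \<rho> x y \<and> x \<in> strip_minus k \<and> y \<in> strip \<rho> k}"
    using in_strip q edge_minus_1_imp_NN
    by (intro sum_le_infsum_ennreal) (auto simp: I_def strip_eq)
  finally have 1: "ennreal (\<Sum>i\<in>I. (d i - 1)\<^sup>2) \<le> \<dots>" by simp
  have "(\<Sum>i\<in>I. ennreal ((d i - \<rho>)\<^sup>2)) =
      (\<Sum>p\<in>(\<lambda>i. (Qpt \<rho> (q i), Ppt i)) ` I. case p of (x, y) \<Rightarrow> ennreal ((norm (u x - u y) - \<rho>)\<^sup>2))"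
    by (subst sum.reindex) (auto simp: inj_on_def d_def norm_minus_commute dest: injD[OF inj])
  also have "\<dots> \<le> infsum (\<lambda>(x, y). ennreal ((norm (u x - u y) - \<rho>)\<^sup>2))
       {(x, y). NN \<rho> x y \<and> x \<in> strip_plus \<rho> k \<and> y \<in> strip \<rho> k}"
    using in_strip q edge_minus_1_imp_NN
    by (intro sum_le_infsum_ennreal) (auto simp: I_def strip_eq)
  finally have 2: "ennreal (\<Sum>i\<in>I. (d i - \<rho>)\<^sup>2) \<le> \<dots>" by simp
  have "(1 - \<rho>)\<^sup>2 / 4 \<le> 1 / 2 * (d i - 1)\<^sup>2 + 1 / 2 * (d i - \<rho>)\<^sup>2" for i
  proof -
    have "1 / 2 * (d i - 1)\<^sup>2 + 1 / 2 * (d i - \<rho>)\<^sup>2 =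
        (1 - \<rho>)\<^sup>2 / 4 + ((d i - 1) + (d i - \<rho>))\<^sup>2 / 4"
      by (simp add: power2_eq_square field_simps)
    then show ?thesis by simp
  qed
  then have "(\<Sum>i\<in>I. (1 - \<rho>)\<^sup>2 / 4) \<le> (\<Sum>i\<in>I. 1 / 2 * (d i - 1)\<^sup>2 + 1 / 2 * (d i - \<rho>)\<^sup>2)"
    by (intro sum_mono)
  then have le: "(1 - \<rho>)\<^sup>2 / 4 * real k \<le> 1 / 2 * (\<Sum>i\<in>I. (d i - 1)\<^sup>2) + 1 / 2 * (\<Sum>i\<in>I. (d i - \<rho>)\<^sup>2)"
    by (simp add: I_def sum.distrib sum_distrib_left mult.commute)
  have half: "0 \<le> (1 / 2 :: real)" and nn: "0 \<le> (\<Sum>i\<in>I. (d i - 1)\<^sup>2)" "0 \<le> (\<Sum>i\<in>I. (d i - \<rho>)\<^sup>2)"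
    by (simp_all add: sum_nonneg)
  from le have "ennreal ((1 - \<rho>)\<^sup>2 / 4 * real k) \<le>
      ennreal (1 / 2 * (\<Sum>i\<in>I. (d i - 1)\<^sup>2) + 1 / 2 * (\<Sum>i\<in>I. (d i - \<rho>)\<^sup>2))"
    by (rule ennreal_leI)
  also have "\<dots> = ennreal (1 / 2) * ennreal (\<Sum>i\<in>I. (d i - 1)\<^sup>2) + ennreal (1 / 2) * ennreal (\<Sum>i\<in>I. (d i - \<rho>)\<^sup>2)"
    using half nn by (simp only: ennreal_plus ennreal_mult mult_nonneg_nonneg)
  also have "\<dots> \<le> energy \<rho> \<rho> k u"
    unfolding energy_def using 1 2 by (intro add_mono mult_left_mono) auto
  finally show ?thesis .
qed

lemma transition_cost_ge:
  assumes "1 \<le> k"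
  shows "ennreal ((1 - \<rho>)\<^sup>2 / 4 * real k) \<le> transition_cost \<rho> \<rho> k"
  unfolding transition_cost_def by (intro INF_greatest energy_ge assms)

end

theorem proposition2p7:
  fixes lam :: real
  assumes "0 < lam" and "lam < 1"
  shows "\<exists>C1 C2 :: real. 0 < C1 \<and> 0 < C2 \<and>
           (\<forall>k :: nat. 1 \<le> k \<longrightarrow>
              ennreal (C1 * real k) \<le> transition_cost lam lam k \<and>
              transition_cost lam lam k \<le> ennreal (C2 * real k))"
proof (intro exI conjI allI impI)
  show "0 < (1 - lam)\<^sup>2 / 4" using assms(2) by simp
  show "0 < 4 * (2 + 1 / lam)" using assms(1) by (simp add: add_pos_pos)
qed (use transition_cost_ge[OF assms] transition_cost_le[OF assms] in auto)

end
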